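(* Let $\mathcal C$ be a join restriction category with local glueings and let $X\in\mathcal C$. The adjunction $\Delta\dashv\Gamma\colon\mathcal C/_tX\to\mathrm{Psh}(X)$ is Galois. In particular, $\mathrm{Sh}(X)$ is reflective in $\mathrm{Psh}(X)$ via $\Gamma\Delta$, while $\mathcal C/_{\ell h}X$ is coreflective in $\mathcal C/_tX$ via $\Delta\Gamma$.
   Context: For an adjunction $F\dashv G\colon\mathcal B\to\mathcal A$, a left fixpoint is an object $B\in\mathcal B$ at which the counit is invertible and a right fixpoint is $A\in\mathcal A$ at which the unit is invertible. The adjunction is Galois if every $FA$ is a left fixpoint (equivalently, every $GB$ is a right fixpoint). A restriction category is a category with an operation assigning to each $f\colon A\to B$ a map $\bar f\colon A\to A$ such that $f\bar f=f$; $\bar f\bar g=\bar g\bar f$ and $\overline{g\bar f}=\bar g\bar f$ for $f\colon A\to B$, $g\colon A\to C$; and $\bar g f=f\,\overline{gf}$ for $f\colon A\to B$, $g\colon B\to C$. $\mathcal O(A)$ is the set of restriction idempotents on $A$ (maps $e\colon A\to A$ with $\bar e=e$). A map $f$ is total if $\bar f=1$. For parallel maps, $f\leqslant g$ iff $f=g\bar f$, and $f\smile g$ (compatible) iff $f\bar g=g\bar f$. A join restriction category is a restriction category in which every pairwise-compatible family of parallel maps has a join for $\leqslant$, and these joins are preserved by precomposition (then each $\mathcal O(A)$ is a locale). A partial isomorphism is a map $s\colon A\to B$ with a (necessarily unique) partial inverse $s^*\colon B\to A$: $s^*s=\bar s$, $ss^*=\overline{s^*}$. A local homeomorphism is a total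 map which is a join of partial isomorphisms. A local atlas on $X$ is a set $I$ and a family $\varphi_{ij}\in\mathcal O(X)$ ($i,j\in I$) with $\varphi_{ij}=\varphi_{ji}$ and $\varphi_{jk}\varphi_{ij}\leqslant\varphi_{ik}$. A glueing of $\varphi$ is a local homeomorphism $p=\bigvee_i p_i\colon A\to X$, with each $p_i$ a partial isomorphism with partial inverse $s_i$, such that $\varphi_{ij}=p_js_i$. $\mathcal C$ has local glueings if every local atlas on every object has a glueing. A partial section of a total map $p\colon A\to X$ is a map $s\colon X\to A$ with $ps=\bar s$. $\mathcal C/_tX$ is the category whose objects are total maps $p\colon A\to X$ and whose maps $p\to q$ are maps $f$ with $qf=p$; $\mathcal C/_{\ell h}X$ is its full subcategory on the local homeomorphisms. A presheaf on $X$ is a set $A$ with an associative unital right action $A\times\mathcal O(X)\to A$, $(a,e)\mapsto ae$ (where $\mathcal O(X)$ is a monoid under composition), and an extent operation $A\to\mathcal O(X)$, $a\mapsto\bar a$, with $a\bar a=a$ and $\overline{ae}=\bar ae$. Put $a\leqslant b$ iff $a=b\bar a$, and $a\smile b$ iff $a\bar b=b\bar a$. $A$ is a sheaf if every pairwise-compatible family has a join for $\leqslant$. $\mathrm{Psh}(X)$ has as maps functions preserving the action and extent; $\mathrm{Sh}(X)$ is the full subcategory of sheaves. $\Gamma$ sends $p$ to the presheaf of partial sections of $p$, with action $s,e\mapsto s\circ e$ and extent $s\mapsto\bar s$, and sends $f\colon p\to q$ to $s\mapsto fs$. For $A\in\mathrm{Psh}(X)$ and $a,b\in A$ let $[\![a=b]\!]=\bigvee\{e\in\mathcal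 O(X): e\leqslant\bar a\bar b,\ ae=be\}$; then $\Delta A$ is a glueing $p_A\colon\Delta A\to X$ of the local atlas $([\![a=b]\!])_{a,b\in A}$, with associated partial sections $s_a$. $\Delta$ is left adjoint to $\Gamma$, with unit $A\to\Gamma\Delta A$ given by $a\mapsto s_a$. *)

theory Defs
  imports "HOL-Library.FuncSet" "HOL-Library.Equipollence"
begin

section \<open>Categories, functors, adjunctions\<close>

record ('o, 'm) cat =
  Ob :: "'o set"
  Ar :: "'m set"
  Dom :: "'m \<Rightarrow> 'o"
  Cod :: "'m \<Rightarrow> 'o"
  Ident :: "'o \<Rightarrow> 'm"
  Comp :: "'m \<Rightarrow> 'm \<Rightarrow> 'm"  (infixl "\<cdot>\<index>" 70)

definition Hom :: "('o, 'm, 'z) cat_scheme \<Rightarrow> 'o \<Rightarrow> 'o \<Rightarrow> 'm set" where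
  "Hom C A B = {f \<in> Ar C. Dom C f = A \<and> Cod C f = B}"

locale category =
  fixes C :: "('o, 'm, 'z) cat_scheme" (structure)
  assumes Dom_Ob: "f \<in> Ar C \<Longrightarrow> Dom C f \<in> Ob C"
    and Cod_Ob: "f \<in> Ar C \<Longrightarrow> Cod C f \<in> Ob C"
    and Ident_Hom: "A \<in> Ob C \<Longrightarrow> Ident C A \<in> Hom C A A"
    and Comp_Hom: "\<lbrakk>f \<in> Hom C A B; g \<in> Hom C B D\<rbrakk> \<Longrightarrow> g \<cdot> f \<in> Hom C A D"
    and Comp_Ident: "f \<in> Hom C A B \<Longrightarrow> f \<cdot> Ident C A = f"
    and Ident_Comp: "f \<in> Hom C A B \<Longrightarrow> Ident C B \<cdot> f = f"
    and Comp_assoc: "\<lbrakk>f \<in> Hom C A B; g \<in> Hom C B D; h \<in> Hom C D E\<rbrakk>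
      \<Longrightarrow> (h \<cdot> g) \<cdot> f = h \<cdot> (g \<cdot> f)"

definition invertible :: "('o, 'm, 'z) cat_scheme \<Rightarrow> 'm \<Rightarrow> bool" where
  "invertible C f \<longleftrightarrow> f \<in> Ar C \<and>
     (\<exists>g \<in> Hom C (Cod C f) (Dom C f).
        Comp C g f = Ident C (Dom C f) \<and> Comp C f g = Ident C (Cod C f))"

definition full_subcategory :: "('o, 'm) cat \<Rightarrow> 'o set \<Rightarrow> ('o, 'm) cat" where
  "full_subcategory D S =
     D\<lparr>Ob := Ob D \<inter> S, Ar := {f \<in> Ar D. Dom D f \<in> S \<and> Cod D f \<in> S}\<rparr>"

record ('o, 'm, 'o2, 'm2) fctr =
  fob :: "'o \<Rightarrow> 'o2"
  far :: "'m \<Rightarrow> 'm2"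

definition is_functor ::
  "('o, 'm) cat \<Rightarrow> ('o2, 'm2) cat \<Rightarrow> ('o, 'm, 'o2, 'm2) fctr \<Rightarrow> bool" where
  "is_functor A B F \<longleftrightarrow> category A \<and> category B \<and>
     (\<forall>a \<in> Ob A. fob F a \<in> Ob B) \<and>
     (\<forall>f \<in> Ar A. far F f \<in> Hom B (fob F (Dom A f)) (fob F (Cod A f))) \<and>
     (\<forall>a \<in> Ob A. far F (Ident A a) = Ident B (fob F a)) \<and>
     (\<forall>f \<in> Ar A. \<forall>g \<in> Ar A. Cod A f = Dom A g \<longrightarrow>
        far F (Comp A g f) = Comp B (far F g) (far F f))"

definition id_functor :: "('o, 'm, 'o, 'm) fctr" where
  "id_functor = \<lparr>fob = \<lambda>a. a, far = \<lambda>f. f\<rparr>"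

definition comp_functor ::
  "('o2, 'm2, 'o3, 'm3) fctr \<Rightarrow> ('o, 'm, 'o2, 'm2) fctr \<Rightarrow> ('o, 'm, 'o3, 'm3) fctr" where
  "comp_functor G F = \<lparr>fob = \<lambda>a. fob G (fob F a), far = \<lambda>f. far G (far F f)\<rparr>"

definition natural_transformation ::
  "('o, 'm) cat \<Rightarrow> ('o2, 'm2) cat \<Rightarrow> ('o, 'm, 'o2, 'm2) fctr \<Rightarrow> ('o, 'm, 'o2, 'm2) fctr
    \<Rightarrow> ('o \<Rightarrow> 'm2) \<Rightarrow> bool" where
  "natural_transformation A B F G \<tau> \<longleftrightarrow>
     (\<forall>a \<in> Ob A. \<tau> a \<in> Hom B (fob F a) (fob G a)) \<and>
     (\<forall>f \<in> Ar A. Comp B (far G f) (\<tau> (Dom A f)) = Comp B (\<tau> (Cod A f)) (far F f))"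

text \<open>\<open>F : A \<rightarrow> B\<close> is left adjoint to \<open>G : B \<rightarrow> A\<close>, with unit \<open>\<eta>\<close> and counit \<open>\<epsilon>\<close>.\<close>

definition adjunction ::
  "('o, 'm) cat \<Rightarrow> ('o2, 'm2) cat \<Rightarrow> ('o, 'm, 'o2, 'm2) fctr \<Rightarrow> ('o2, 'm2, 'o, 'm) fctr
    \<Rightarrow> ('o \<Rightarrow> 'm) \<Rightarrow> ('o2 \<Rightarrow> 'm2) \<Rightarrow> bool" where
  "adjunction A B F G \<eta> \<epsilon> \<longleftrightarrow>
     is_functor A B F \<and> is_functor B A G \<and>
     natural_transformation A A id_functor (comp_functor G F) \<eta> \<and>
     natural_transformation B B (comp_functor F G) id_functor \<epsilon> \<and>
     (\<forall>a \<in> Ob A. Comp B (\<epsilon> (fob F a)) (far F (\<eta> a)) = Ident B (fob F a)) \<and>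
     (\<forall>b \<in> Ob B. Comp A (far G (\<epsilon> b)) (\<eta> (fob G b)) = Ident A (fob G b))"

definition left_fixpoint :: "('o2, 'm2) cat \<Rightarrow> ('o2 \<Rightarrow> 'm2) \<Rightarrow> 'o2 \<Rightarrow> bool" where
  "left_fixpoint B \<epsilon> b \<longleftrightarrow> b \<in> Ob B \<and> invertible B (\<epsilon> b)"

definition galois_adjunction ::
  "('o, 'm) cat \<Rightarrow> ('o2, 'm2) cat \<Rightarrow> ('o, 'm, 'o2, 'm2) fctr \<Rightarrow> ('o2, 'm2, 'o, 'm) fctr
    \<Rightarrow> ('o \<Rightarrow> 'm) \<Rightarrow> ('o2 \<Rightarrow> 'm2) \<Rightarrow> bool" where
  "galois_adjunction A B F G \<eta> \<epsilon> \<longleftrightarrow>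
     adjunction A B F G \<eta> \<epsilon> \<and> (\<forall>a \<in> Ob A. left_fixpoint B \<epsilon> (fob F a))"

text \<open>For a subcategory \<open>S\<close> of \<open>D\<close>: the inclusion \<open>S \<rightarrow> D\<close> (on underlying data, the
  identity) has the left, respectively right, adjoint \<open>R : D \<rightarrow> S\<close>.\<close>

definition reflective_via ::
  "('o, 'm) cat \<Rightarrow> ('o, 'm) cat \<Rightarrow> ('o, 'm, 'o, 'm) fctr \<Rightarrow> ('o \<Rightarrow> 'm) \<Rightarrow> bool" where
  "reflective_via D S R \<eta> \<longleftrightarrow> (\<exists>\<epsilon>. adjunction D S R id_functor \<eta> \<epsilon>)"

definition coreflective_via ::
  "('o, 'm) cat \<Rightarrow> ('o, 'm) cat \<Rightarrow> ('o, 'm, 'o, 'm) fctr \<Rightarrow> ('o \<Rightarrow> 'm) \<Rightarrow> bool" where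
  "coreflective_via D S R \<epsilon> \<longleftrightarrow> (\<exists>\<eta>. adjunction S D id_functor R \<eta> \<epsilon>)"

text \<open>A left adjoint to \<open>G : B \<rightarrow> A\<close> with prescribed values \<open>F0\<close> on objects and prescribed unit
  \<open>\<eta>\<close> has its action on arrows and its counit forced by the universal property of \<open>\<eta>\<close>.\<close>

definition left_adjoint_of_unit ::
  "('o, 'm) cat \<Rightarrow> ('o2, 'm2) cat \<Rightarrow> ('o \<Rightarrow> 'o2) \<Rightarrow> ('o2, 'm2, 'o, 'm) fctr \<Rightarrow> ('o \<Rightarrow> 'm)
    \<Rightarrow> ('o, 'm, 'o2, 'm2) fctr" where
  "left_adjoint_of_unit A B F0 G \<eta> =
     \<lparr>fob = F0,
      far = \<lambda>h. THE k. k \<in> Hom B (F0 (Dom A h)) (F0 (Cod A h)) \<and>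
                       Comp A (far G k) (\<eta> (Dom A h)) = Comp A (\<eta> (Cod A h)) h\<rparr>"

definition counit_of_unit ::
  "('o, 'm) cat \<Rightarrow> ('o2, 'm2) cat \<Rightarrow> ('o \<Rightarrow> 'o2) \<Rightarrow> ('o2, 'm2, 'o, 'm) fctr \<Rightarrow> ('o \<Rightarrow> 'm)
    \<Rightarrow> 'o2 \<Rightarrow> 'm2" where
  "counit_of_unit A B F0 G \<eta> b =
     (THE k. k \<in> Hom B (F0 (fob G b)) b \<and>
             Comp A (far G k) (\<eta> (fob G b)) = Ident A (fob G b))"

section \<open>Size\<close>

text \<open>The arrow type \<open>'m\<close> of the ambient category plays the role of the universe: following
  the principle of limitation of size, its subsets are the classes, and the sets are
  those classes which are not as large as the universe. Without such a distinction, the existence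
  of glueings of all atlases would be contradictory for size reasons: an \<open>I\<close>-fold copower of an
  object with a nontrivial restriction idempotent has at least \<open>2\<^sup>I\<close> restriction
  idempotents. Every \<open>I\<close> of cardinality below that of \<open>'m\<close> is in bijection with a
  subset of \<open>'m\<close>, so index sets and presheaves can be taken inside \<open>'m\<close>.\<close>

definition small :: "'m set \<Rightarrow> bool" where
  "small S \<longleftrightarrow> S \<prec> (UNIV :: 'm set)"

definition locally_small :: "('o, 'm, 'z) cat_scheme \<Rightarrow> bool" where
  "locally_small C \<longleftrightarrow> (\<forall>A \<in> Ob C. \<forall>B \<in> Ob C. small (Hom C A B))"

section \<open>Join restriction categories\<close>

record ('o, 'm) rcat = "('o, 'm) cat" +
  Rst :: "'m \<Rightarrow> 'm"

locale restriction_category = category C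
  for C :: "('o, 'm, 'z) rcat_scheme" (structure) +
  assumes Rst_Hom: "f \<in> Hom C A B \<Longrightarrow> Rst C f \<in> Hom C A A"
    and Comp_Rst: "f \<in> Hom C A B \<Longrightarrow> f \<cdot> Rst C f = f"
    and Rst_commute: "\<lbrakk>f \<in> Hom C A B; g \<in> Hom C A D\<rbrakk>
      \<Longrightarrow> Rst C f \<cdot> Rst C g = Rst C g \<cdot> Rst C f"
    and Rst_Comp_Rst: "\<lbrakk>f \<in> Hom C A B; g \<in> Hom C A D\<rbrakk>
      \<Longrightarrow> Rst C (g \<cdot> Rst C f) = Rst C g \<cdot> Rst C f"
    and Rst_Comp: "\<lbrakk>f \<in> Hom C A B; g \<in> Hom C B D\<rbrakk>
      \<Longrightarrow> Rst C g \<cdot> f = f \<cdot> Rst C (g \<cdot> f)"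

definition rest_idem :: "('o, 'm, 'z) rcat_scheme \<Rightarrow> 'o \<Rightarrow> 'm set" where
  "rest_idem C A = {e \<in> Hom C A A. Rst C e = e}"

definition total_map :: "('o, 'm, 'z) rcat_scheme \<Rightarrow> 'm \<Rightarrow> bool" where
  "total_map C f \<longleftrightarrow> f \<in> Ar C \<and> Rst C f = Ident C (Dom C f)"

definition parallel :: "('o, 'm, 'z) cat_scheme \<Rightarrow> 'm \<Rightarrow> 'm \<Rightarrow> bool" where
  "parallel C f g \<longleftrightarrow> f \<in> Ar C \<and> g \<in> Ar C \<and> Dom C f = Dom C g \<and> Cod C f = Cod C g"

definition rle :: "('o, 'm, 'z) rcat_scheme \<Rightarrow> 'm \<Rightarrow> 'm \<Rightarrow> bool" where
  "rle C f g \<longleftrightarrow> parallel C f g \<and> f = Comp C g (Rst C f)"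

definition compatible :: "('o, 'm, 'z) rcat_scheme \<Rightarrow> 'm \<Rightarrow> 'm \<Rightarrow> bool" where
  "compatible C f g \<longleftrightarrow> parallel C f g \<and> Comp C f (Rst C g) = Comp C g (Rst C f)"

definition is_join :: "('a \<Rightarrow> 'a \<Rightarrow> bool) \<Rightarrow> 'a set \<Rightarrow> 'a set \<Rightarrow> 'a \<Rightarrow> bool" where
  "is_join le S F h \<longleftrightarrow>
     h \<in> S \<and> (\<forall>f \<in> F. le f h) \<and> (\<forall>k \<in> S. (\<forall>f \<in> F. le f k) \<longrightarrow> le h k)"

locale join_restriction_category = restriction_category C
  for C :: "('o, 'm, 'z) rcat_scheme" (structure) +
  assumes join_exists: "\<lbrakk>A \<in> Ob C; B \<in> Ob C; F \<subseteq> Hom C A B;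
        \<forall>f \<in> F. \<forall>g \<in> F. compatible C f g\<rbrakk>
      \<Longrightarrow> \<exists>h. is_join (rle C) (Hom C A B) F h"
    and join_precomp: "\<lbrakk>A \<in> Ob C; B \<in> Ob C; F \<subseteq> Hom C A B;
        \<forall>f \<in> F. \<forall>g \<in> F. compatible C f g;
        is_join (rle C) (Hom C A B) F h; g \<in> Hom C Z A\<rbrakk>
      \<Longrightarrow> is_join (rle C) (Hom C Z B) ((\<lambda>f. f \<cdot> g) ` F) (h \<cdot> g)"

definition partial_inverse :: "('o, 'm, 'z) rcat_scheme \<Rightarrow> 'm \<Rightarrow> 'm \<Rightarrow> bool" where
  "partial_inverse C s t \<longleftrightarrow>
     s \<in> Ar C \<and> t \<in> Hom C (Cod C s) (Dom C s) \<and>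
     Comp C t s = Rst C s \<and> Comp C s t = Rst C t"

definition partial_iso :: "('o, 'm, 'z) rcat_scheme \<Rightarrow> 'm \<Rightarrow> bool" where
  "partial_iso C s \<longleftrightarrow> (\<exists>t. partial_inverse C s t)"

definition local_homeomorphism :: "('o, 'm, 'z) rcat_scheme \<Rightarrow> 'm \<Rightarrow> bool" where
  "local_homeomorphism C p \<longleftrightarrow> total_map C p \<and>
     (\<exists>F \<subseteq> {s \<in> Hom C (Dom C p) (Cod C p). partial_iso C s}.
        is_join (rle C) (Hom C (Dom C p) (Cod C p)) F p)"

definition local_atlas ::
  "('o, 'm, 'z) rcat_scheme \<Rightarrow> 'o \<Rightarrow> 'i set \<Rightarrow> ('i \<Rightarrow> 'i \<Rightarrow> 'm) \<Rightarrow> bool" where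
  "local_atlas C X I \<phi> \<longleftrightarrow>
     (\<forall>i \<in> I. \<forall>j \<in> I. \<phi> i j \<in> rest_idem C X \<and> \<phi> i j = \<phi> j i) \<and>
     (\<forall>i \<in> I. \<forall>j \<in> I. \<forall>k \<in> I. rle C (Comp C (\<phi> j k) (\<phi> i j)) (\<phi> i k))"

text \<open>A glueing is recorded by the map \<open>p\<close> together with the partial sections \<open>s i\<close>; the
  partial isomorphisms \<open>p\<^sub>i\<close> are the partial inverses of the \<open>s i\<close>.\<close>

definition is_glueing ::
  "('o, 'm, 'z) rcat_scheme \<Rightarrow> 'o \<Rightarrow> 'i set \<Rightarrow> ('i \<Rightarrow> 'i \<Rightarrow> 'm) \<Rightarrow> 'm \<Rightarrow> ('i \<Rightarrow> 'm) \<Rightarrow> bool" where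
  "is_glueing C X I \<phi> p s \<longleftrightarrow>
     local_homeomorphism C p \<and> Cod C p = X \<and>
     (\<exists>P. (\<forall>i \<in> I. P i \<in> Hom C (Dom C p) X \<and> partial_inverse C (P i) (s i)) \<and>
          is_join (rle C) (Hom C (Dom C p) X) (P ` I) p \<and>
          (\<forall>i \<in> I. \<forall>j \<in> I. \<phi> i j = Comp C (P j) (s i)))"

definition has_local_glueings :: "('o, 'm, 'z) rcat_scheme \<Rightarrow> bool" where
  "has_local_glueings C \<longleftrightarrow>
     (\<forall>X \<in> Ob C. \<forall>(I :: 'm set) \<phi>. small I \<and> local_atlas C X I \<phi> \<longrightarrow>
        (\<exists>p s. is_glueing C X I \<phi> p s))"

section \<open>Slice categories\<close>

text \<open>An arrow \<open>p \<rightarrow> q\<close> is the triple \<open>(p, f, q)\<close>, so that it determines its domain and codomain.\<close>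

definition slice_t :: "('o, 'm, 'z) rcat_scheme \<Rightarrow> 'o \<Rightarrow> ('m, 'm \<times> 'm \<times> 'm) cat" where
  "slice_t C X =
     (let objs = {p \<in> Ar C. total_map C p \<and> Cod C p = X} in
      \<lparr>Ob = objs,
       Ar = {(p, f, q). p \<in> objs \<and> q \<in> objs \<and> f \<in> Hom C (Dom C p) (Dom C q) \<and> Comp C q f = p},
       Dom = \<lambda>(p, f, q). p,
       Cod = \<lambda>(p, f, q). q,
       Ident = \<lambda>p. (p, Ident C (Dom C p), p),
       Comp = \<lambda>(q', g, r) (p, f, q). (p, Comp C g f, r)\<rparr>)"

definition slice_lh :: "('o, 'm, 'z) rcat_scheme \<Rightarrow> 'o \<Rightarrow> ('m, 'm \<times> 'm \<times> 'm) cat" where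
  "slice_lh C X = full_subcategory (slice_t C X) {p. local_homeomorphism C p}"

section \<open>Presheaves and sheaves\<close>

record ('a, 'm) presheaf =
  elts :: "'a set"
  action :: "'a \<Rightarrow> 'm \<Rightarrow> 'a"
  extent :: "'a \<Rightarrow> 'm"

definition is_presheaf :: "('o, 'm, 'z) rcat_scheme \<Rightarrow> 'o \<Rightarrow> ('a, 'm) presheaf \<Rightarrow> bool" where
  "is_presheaf C X A \<longleftrightarrow>
     (\<forall>a \<in> elts A. \<forall>e \<in> rest_idem C X. action A a e \<in> elts A) \<and>
     (\<forall>a \<in> elts A. action A a (Ident C X) = a) \<and>
     (\<forall>a \<in> elts A. \<forall>e \<in> rest_idem C X. \<forall>e' \<in> rest_idem C X.
        action A (action A a e) e' = action A a (Comp C e e')) \<and>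
     (\<forall>a \<in> elts A. extent A a \<in> rest_idem C X) \<and>
     (\<forall>a \<in> elts A. action A a (extent A a) = a) \<and>
     (\<forall>a \<in> elts A. \<forall>e \<in> rest_idem C X.
        extent A (action A a e) = Comp C (extent A a) e)"

definition psh_le :: "('a, 'm) presheaf \<Rightarrow> 'a \<Rightarrow> 'a \<Rightarrow> bool" where
  "psh_le A a b \<longleftrightarrow> a = action A b (extent A a)"

definition psh_compatible :: "('a, 'm) presheaf \<Rightarrow> 'a \<Rightarrow> 'a \<Rightarrow> bool" where
  "psh_compatible A a b \<longleftrightarrow> action A a (extent A b) = action A b (extent A a)"

definition is_sheaf :: "('o, 'm, 'z) rcat_scheme \<Rightarrow> 'o \<Rightarrow> ('a, 'm) presheaf \<Rightarrow> bool" where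
  "is_sheaf C X A \<longleftrightarrow> is_presheaf C X A \<and>
     (\<forall>F \<subseteq> elts A. (\<forall>a \<in> F. \<forall>b \<in> F. psh_compatible A a b) \<longrightarrow>
        (\<exists>c. is_join (psh_le A) (elts A) F c))"

definition presheaf_map ::
  "('o, 'm, 'z) rcat_scheme \<Rightarrow> 'o \<Rightarrow> ('a, 'm) presheaf \<Rightarrow> ('b, 'm) presheaf \<Rightarrow> ('a \<Rightarrow> 'b) \<Rightarrow> bool" where
  "presheaf_map C X A B h \<longleftrightarrow> h \<in> elts A \<rightarrow>\<^sub>E elts B \<and>
     (\<forall>a \<in> elts A. \<forall>e \<in> rest_idem C X. h (action A a e) = action B (h a) e) \<and>
     (\<forall>a \<in> elts A. extent B (h a) = extent A a)"

type_synonym 'm psh_arrow = "('m, 'm) presheaf \<times> ('m \<Rightarrow> 'm) \<times> ('m, 'm) presheaf"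

definition Psh :: "('o, 'm, 'z) rcat_scheme \<Rightarrow> 'o \<Rightarrow> (('m, 'm) presheaf, 'm psh_arrow) cat" where
  "Psh C X =
     (let objs = {A. is_presheaf C X A \<and> small (elts A)} in
      \<lparr>Ob = objs,
       Ar = {(A, h, B). A \<in> objs \<and> B \<in> objs \<and> presheaf_map C X A B h},
       Dom = \<lambda>(A, h, B). A,
       Cod = \<lambda>(A, h, B). B,
       Ident = \<lambda>A. (A, \<lambda>a \<in> elts A. a, A),
       Comp = \<lambda>(B', k, D) (A, h, B). (A, compose (elts A) k h, D)\<rparr>)"

definition Sh :: "('o, 'm, 'z) rcat_scheme \<Rightarrow> 'o \<Rightarrow> (('m, 'm) presheaf, 'm psh_arrow) cat" where
  "Sh C X = full_subcategory (Psh C X) {A. is_sheaf C X A}"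

section \<open>The functors \<open>\<Gamma>\<close> and \<open>\<Delta>\<close>\<close>

definition partial_section :: "('o, 'm, 'z) rcat_scheme \<Rightarrow> 'm \<Rightarrow> 'm \<Rightarrow> bool" where
  "partial_section C p s \<longleftrightarrow> s \<in> Hom C (Cod C p) (Dom C p) \<and> Comp C p s = Rst C s"

definition Gamma_ob :: "('o, 'm, 'z) rcat_scheme \<Rightarrow> 'm \<Rightarrow> ('m, 'm) presheaf" where
  "Gamma_ob C p =
     \<lparr>elts = {s. partial_section C p s}, action = \<lambda>s e. Comp C s e, extent = \<lambda>s. Rst C s\<rparr>"

definition Gamma ::
  "('o, 'm, 'z) rcat_scheme \<Rightarrow> ('m, 'm \<times> 'm \<times> 'm, ('m, 'm) presheaf, 'm psh_arrow) fctr" where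
  "Gamma C =
     \<lparr>fob = Gamma_ob C,
      far = \<lambda>(p, f, q). (Gamma_ob C p, \<lambda>s \<in> elts (Gamma_ob C p). Comp C f s, Gamma_ob C q)\<rparr>"

definition psh_eq ::
  "('o, 'm, 'z) rcat_scheme \<Rightarrow> 'o \<Rightarrow> ('a, 'm) presheaf \<Rightarrow> 'a \<Rightarrow> 'a \<Rightarrow> 'm" where
  "psh_eq C X A a b =
     (THE d. is_join (rle C) (rest_idem C X)
        {e \<in> rest_idem C X. rle C e (Comp C (extent A a) (extent A b)) \<and>
                            action A a e = action A b e} d)"

definition Delta_glueing ::
  "('o, 'm, 'z) rcat_scheme \<Rightarrow> 'o \<Rightarrow> ('m, 'm) presheaf \<Rightarrow> 'm \<times> ('m \<Rightarrow> 'm)" where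
  "Delta_glueing C X A = (SOME (p, s). is_glueing C X (elts A) (psh_eq C X A) p s)"

definition Delta_ob :: "('o, 'm, 'z) rcat_scheme \<Rightarrow> 'o \<Rightarrow> ('m, 'm) presheaf \<Rightarrow> 'm" where
  "Delta_ob C X A = fst (Delta_glueing C X A)"

definition Delta_section ::
  "('o, 'm, 'z) rcat_scheme \<Rightarrow> 'o \<Rightarrow> ('m, 'm) presheaf \<Rightarrow> 'm \<Rightarrow> 'm" where
  "Delta_section C X A = snd (Delta_glueing C X A)"

definition Delta_unit :: "('o, 'm, 'z) rcat_scheme \<Rightarrow> 'o \<Rightarrow> ('m, 'm) presheaf \<Rightarrow> 'm psh_arrow" where
  "Delta_unit C X A =
     (A, \<lambda>a \<in> elts A. Delta_section C X A a, Gamma_ob C (Delta_ob C X A))"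

definition Delta ::
  "('o, 'm, 'z) rcat_scheme \<Rightarrow> 'o \<Rightarrow> (('m, 'm) presheaf, 'm psh_arrow, 'm, 'm \<times> 'm \<times> 'm) fctr" where
  "Delta C X =
     left_adjoint_of_unit (Psh C X) (slice_t C X) (Delta_ob C X) (Gamma C) (Delta_unit C X)"

definition Delta_counit :: "('o, 'm, 'z) rcat_scheme \<Rightarrow> 'o \<Rightarrow> 'm \<Rightarrow> 'm \<times> 'm \<times> 'm" where
  "Delta_counit C X =
     counit_of_unit (Psh C X) (slice_t C X) (Delta_ob C X) (Gamma C) (Delta_unit C X)"

end

(*
  The glueing p_A of A comes with partial sections s_a and charts P_a. A map out of it is determined
  by its composites with the s_a, and the join of the h(a) P_a realises any presheaf map h from A
  to the partial sections of a total map, so s is a universal arrow to Gamma.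
  A local homeomorphism is itself covered by partial isomorphisms, whose inverses are partial
  sections; the same covering argument makes Gamma fully faithful on maps out of it, so the unit
  at Gamma p is Gamma m for some m, and m inverts the counit at p. As every Delta A is a
  local homeomorphism, the adjunction is Galois. For a sheaf A, any partial section x of p_A is s_c
  for c the join of the elements a (P_a x), so the unit at A is bijective.
*)
theory Submission
  imports Defs
begin

section \<open>Universal arrows and adjunctions\<close>

text \<open>Joins are assumed stable under precomposition only, while gluing arguments need the
  other side: maps that agree on the domains of a covering family should agree on the domain of its
  join. \<open>eq_on_join\<close> extracts this from the axioms. Uniqueness of maps out of a
  glueing, the passage from witnesses of equality to their join, and the closure of partial sections
  under joins all rest on it. The obstacle on the presheaf side is that
  \<open>psh_eq C X A a b\<close> is a join of idempotents on which \<open>a\<close> and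
  \<open>b\<close> agree, and in a presheaf that is not a sheaf they may disagree on the join
  itself. So computations in \<open>A\<close> go witness by witness, whereas the glued sections do
  agree on the join. For a sheaf this separation has to be proved, and it gives injectivity of the
  unit. The glueing is chosen by \<open>SOME\<close>, the arrow part of \<Delta> and the counit by
  \<open>THE\<close>; they are handled through their universal property and never computed. The two
  subcategory statements need that every sheaf and every local homeomorphism is a fixpoint, which is
  a separate matter from the Galois property.\<close>

lemma Hom_iff: "f \<in> Hom C A B \<longleftrightarrow> f \<in> Ar C \<and> Dom C f = A \<and> Cod C f = B"
  by (auto simp: Hom_def)

context category
begin

lemma comp_arrow [simp]:
  assumes "f \<in> Ar C" "g \<in> Ar C" "Dom C g = Cod C f"
  shows "g \<cdot> f \<in> Ar C" "Dom C (g \<cdot> f) = Dom C f" "Cod C (g \<cdot> f) = Cod C g"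
  using Comp_Hom[of f "Dom C f" "Cod C f" g "Cod C g"] assms by (auto simp: Hom_iff)

lemma comp_assoc:
  assumes "f \<in> Ar C" "g \<in> Ar C" "h \<in> Ar C" "Dom C g = Cod C f" "Dom C h = Cod C g"
  shows "(h \<cdot> g) \<cdot> f = h \<cdot> (g \<cdot> f)"
  using Comp_assoc[of f "Dom C f" "Cod C f" g "Cod C g" h "Cod C h"] assms
  by (auto simp: Hom_iff)

lemma ident_arrow [simp]:
  assumes "A \<in> Ob C"
  shows "Ident C A \<in> Ar C" "Dom C (Ident C A) = A" "Cod C (Ident C A) = A"
  using Ident_Hom[OF assms] by (auto simp: Hom_iff)

lemma comp_ident [simp]: "f \<in> Ar C \<Longrightarrow> Dom C f = A \<Longrightarrow> f \<cdot> Ident C A = f"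
  by (rule Comp_Ident) (auto simp: Hom_iff)

lemma ident_comp [simp]: "f \<in> Ar C \<Longrightarrow> Cod C f = A \<Longrightarrow> Ident C A \<cdot> f = f"
  by (rule Ident_Comp) (auto simp: Hom_iff)

declare Dom_Ob [simp] Cod_Ob [simp]

definition inverse_of :: "'m \<Rightarrow> 'm" where
  "inverse_of f = (SOME g. g \<in> Hom C (Cod C f) (Dom C f) \<and>
     g \<cdot> f = Ident C (Dom C f) \<and> f \<cdot> g = Ident C (Cod C f))"

lemma inverse_of:
  assumes "invertible C f"
  shows "inverse_of f \<in> Ar C" "Dom C (inverse_of f) = Cod C f" "Cod C (inverse_of f) = Dom C f"
    "inverse_of f \<cdot> f = Ident C (Dom C f)" "f \<cdot> inverse_of f = Ident C (Cod C f)"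
proof -
  have "\<exists>g. g \<in> Hom C (Cod C f) (Dom C f) \<and>
     g \<cdot> f = Ident C (Dom C f) \<and> f \<cdot> g = Ident C (Cod C f)"
    using assms by (auto simp: invertible_def)
  from someI_ex[OF this] show "inverse_of f \<in> Ar C" "Dom C (inverse_of f) = Cod C f"
    "Cod C (inverse_of f) = Dom C f"
    "inverse_of f \<cdot> f = Ident C (Dom C f)" "f \<cdot> inverse_of f = Ident C (Cod C f)"
    by (auto simp: inverse_of_def Hom_iff)
qed

text \<open>With invertibility known beforehand, a one-sided inverse suffices: cancel it against the
  chosen two-sided one. Thus a single triangle identity determines the inverse of a unit or
  counit.\<close>

lemma inverse_of_eqI:
  assumes inv: "invertible C f" and "g \<in> Ar C" "Dom C g = Cod C f" "Cod C g = Dom C f"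
    "g \<cdot> f = Ident C (Dom C f) \<or> f \<cdot> g = Ident C (Cod C f)"
  shows "inverse_of f = g"
  using assms(5)
proof
  have f: "f \<in> Ar C" using inv by (simp add: invertible_def)
  note i = inverse_of[OF inv] f assms
  { assume "g \<cdot> f = Ident C (Dom C f)"
    have "(g \<cdot> f) \<cdot> inverse_of f = g \<cdot> (f \<cdot> inverse_of f)"
      using i by (intro comp_assoc) auto
    with i \<open>g \<cdot> f = _\<close> show ?thesis by simp }
  { assume "f \<cdot> g = Ident C (Cod C f)"
    have "(inverse_of f \<cdot> f) \<cdot> g = inverse_of f \<cdot> (f \<cdot> g)"
      using i by (intro comp_assoc) auto
    with i \<open>f \<cdot> g = _\<close> show ?thesis by simp }
qed

text \<open>Here \<open>u\<close> and \<open>v\<close> stand for components of a unit or counit,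
  whose inverses are to become the counit or unit of an inclusion functor.\<close>

lemma inverse_of_natural:
  assumes i: "invertible C u" and j: "invertible C v"
    and "f \<in> Ar C" "g \<in> Ar C" "Dom C f = Dom C u" "Cod C f = Dom C v"
    "Dom C g = Cod C u" "Cod C g = Cod C v"
    and eq: "g \<cdot> u = v \<cdot> f"
  shows "f \<cdot> inverse_of u = inverse_of v \<cdot> g"
proof -
  have uv: "u \<in> Ar C" "v \<in> Ar C" using i j by (auto simp: invertible_def)
  note [simp] = inverse_of(1-3)[OF i] inverse_of(1-3)[OF j] uv assms(3-8)
  have "f \<cdot> inverse_of u = (inverse_of v \<cdot> v) \<cdot> (f \<cdot> inverse_of u)"
    by (simp add: inverse_of(4)[OF j])
  also have "\<dots> = inverse_of v \<cdot> ((v \<cdot> f) \<cdot> inverse_of u)"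
    by (simp add: comp_assoc)
  also have "\<dots> = inverse_of v \<cdot> (g \<cdot> (u \<cdot> inverse_of u))"
    unfolding eq[symmetric] by (simp add: comp_assoc)
  finally show ?thesis by (simp add: inverse_of(5)[OF i])
qed

end

lemma category_full_subcategory:
  assumes "category D"
  shows "category (full_subcategory D S)"
proof -
  interpret category D by fact
  show ?thesis
    by unfold_locales (auto simp: full_subcategory_def Hom_iff comp_assoc)
qed

lemma full_subcategory_sel [simp]:
  "Ob (full_subcategory D S) = Ob D \<inter> S"
  "Dom (full_subcategory D S) = Dom D" "Cod (full_subcategory D S) = Cod D"
  "Ident (full_subcategory D S) = Ident D" "Comp (full_subcategory D S) = Comp D"
  "Ar (full_subcategory D S) = {f \<in> Ar D. Dom D f \<in> S \<and> Cod D f \<in> S}"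
  by (simp_all add: full_subcategory_def)

lemma functor_sel [simp]:
  "fob id_functor a = a" "far id_functor f = f"
  "fob (comp_functor G F) a = fob G (fob F a)" "far (comp_functor G F) f = far G (far F f)"
  by (simp_all add: id_functor_def comp_functor_def)

lemma functorD:
  assumes "is_functor A B F"
  shows "category A" "category B"
    "\<And>a. a \<in> Ob A \<Longrightarrow> fob F a \<in> Ob B"
    "\<And>f. f \<in> Ar A \<Longrightarrow> far F f \<in> Ar B"
    "\<And>f. f \<in> Ar A \<Longrightarrow> Dom B (far F f) = fob F (Dom A f)"
    "\<And>f. f \<in> Ar A \<Longrightarrow> Cod B (far F f) = fob F (Cod A f)"
    "\<And>a. a \<in> Ob A \<Longrightarrow> far F (Ident A a) = Ident B (fob F a)"
    "\<And>f g. \<lbrakk>f \<in> Ar A; g \<in> Ar A; Dom A g = Cod A f\<rbrakk>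
      \<Longrightarrow> far F (Comp A g f) = Comp B (far F g) (far F f)"
  using assms unfolding is_functor_def Hom_iff by auto

section \<open>Fixpoints of an adjunction and the reflections they induce\<close>

locale adjoint_pair =
  fixes A :: "('o, 'm) cat" and B :: "('o2, 'm2) cat" and F G \<eta> \<epsilon>
  assumes adj: "adjunction A B F G \<eta> \<epsilon>"
begin

lemma functors: "is_functor A B F" "is_functor B A G"
  using adj by (auto simp: adjunction_def)

sublocale A: category A by (rule functorD(1)[OF functors(1)])
sublocale B: category B by (rule functorD(1)[OF functors(2)])

lemmas F [simp] = functorD(3-)[OF functors(1)]
lemmas G [simp] = functorD(3-)[OF functors(2)]

lemma unit [simp]:
  "a \<in> Ob A \<Longrightarrow> \<eta> a \<in> Ar A" "a \<in> Ob A \<Longrightarrow> Dom A (\<eta> a) = a"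
  "a \<in> Ob A \<Longrightarrow> Cod A (\<eta> a) = fob G (fob F a)"
  using adj by (auto simp: adjunction_def natural_transformation_def Hom_iff)

lemma counit [simp]:
  "b \<in> Ob B \<Longrightarrow> \<epsilon> b \<in> Ar B" "b \<in> Ob B \<Longrightarrow> Dom B (\<epsilon> b) = fob F (fob G b)"
  "b \<in> Ob B \<Longrightarrow> Cod B (\<epsilon> b) = b"
  using adj by (auto simp: adjunction_def natural_transformation_def Hom_iff)

lemma unit_natural:
  "f \<in> Ar A \<Longrightarrow> Comp A (far G (far F f)) (\<eta> (Dom A f)) = Comp A (\<eta> (Cod A f)) f"
  using adj by (auto simp: adjunction_def natural_transformation_def)

lemma counit_natural:
  "f \<in> Ar B \<Longrightarrow> Comp B f (\<epsilon> (Dom B f)) = Comp B (\<epsilon> (Cod B f)) (far F (far G f))"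
  using adj by (auto simp: adjunction_def natural_transformation_def)

lemma triangles:
  "a \<in> Ob A \<Longrightarrow> Comp B (\<epsilon> (fob F a)) (far F (\<eta> a)) = Ident B (fob F a)"
  "b \<in> Ob B \<Longrightarrow> Comp A (far G (\<epsilon> b)) (\<eta> (fob G b)) = Ident A (fob G b)"
  using adj by (auto simp: adjunction_def)

text \<open>Fullness is required at the one arrow \<open>\<eta> (fob G b)\<close> and faithfulness
  at an identity. If \<open>far G m\<close> is that arrow, naturality of the counit at
  \<open>m\<close> turns \<open>m\<close> after \<open>\<epsilon> b\<close> into one triangle, and
  \<open>G\<close> sends \<open>\<epsilon> b\<close> after \<open>m\<close> to the other.\<close>

lemma counit_invertible:
  assumes b: "b \<in> Ob B"
    and full: "\<exists>m \<in> Hom B b (fob F (fob G b)). far G m = \<eta> (fob G b)"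
    and faithful: "\<And>k. \<lbrakk>k \<in> Hom B b b; far G k = Ident A (fob G b)\<rbrakk> \<Longrightarrow> k = Ident B b"
  shows "invertible B (\<epsilon> b)"
proof -
  obtain m where m: "m \<in> Ar B" "Dom B m = b" "Cod B m = fob F (fob G b)"
    and Gm: "far G m = \<eta> (fob G b)"
    using full by (auto simp: Hom_iff)
  have "Comp B m (\<epsilon> b) = Ident B (fob F (fob G b))"
    using counit_natural[OF m(1)] Gm triangles(1)[of "fob G b"] b m by simp
  moreover have "Comp B (\<epsilon> b) m = Ident B b"
    by (rule faithful) (use b m Gm triangles(2)[OF b] in \<open>auto simp: Hom_iff\<close>)
  ultimately show ?thesis
    using b m by (auto simp: invertible_def Hom_iff)
qed

text \<open>The counit of the inclusion of \<open>S\<close> is the inverse of \<eta> on objects of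
  \<open>S\<close>. One triangle is then immediate. For the other, the inverse at
  \<open>fob G (fob F a)\<close> is \<open>far G (\<epsilon> (fob F a))\<close>, so it is the image
  under \<open>G\<close> of a triangle of the given adjunction.\<close>

lemma reflective:
  assumes GF: "\<And>a. a \<in> Ob A \<Longrightarrow> fob G (fob F a) \<in> S"
    and inv: "\<And>a. a \<in> Ob A \<Longrightarrow> a \<in> S \<Longrightarrow> invertible A (\<eta> a)"
  shows "reflective_via A (full_subcategory A S) (comp_functor G F) \<eta>"
proof -
  define \<delta> where "\<delta> a = A.inverse_of (\<eta> a)" for a
  have \<delta> [simp]: "\<delta> a \<in> Ar A" "Dom A (\<delta> a) = fob G (fob F a)" "Cod A (\<delta> a) = a"
    "Comp A (\<delta> a) (\<eta> a) = Ident A a" "Comp A (\<eta> a) (\<delta> a) = Ident A (fob G (fob F a))"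
    if "a \<in> Ob A" "a \<in> S" for a
    using A.inverse_of[OF inv[OF that]] that by (auto simp: \<delta>_def)
  have \<delta>_GF: "\<delta> (fob G (fob F a)) = far G (\<epsilon> (fob F a))" if "a \<in> Ob A" for a
    unfolding \<delta>_def
    by (rule A.inverse_of_eqI) (use that GF inv triangles(2) in auto)
  have \<delta>_natural: "Comp A f (\<delta> (Dom A f)) = Comp A (\<delta> (Cod A f)) (far G (far F f))"
    if "f \<in> Ar A" "Dom A f \<in> S" "Cod A f \<in> S" for f
    unfolding \<delta>_def
    by (rule A.inverse_of_natural) (use that inv unit_natural in auto)
  have triangle: "Comp A (\<delta> (fob G (fob F a))) (far G (far F (\<eta> a))) = Ident A (fob G (fob F a))"
    if "a \<in> Ob A" for a
    \<comment> \<open>\<open>G(6)\<close> is removed from the simpset so that the composite under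
      \<open>G\<close> collapses by the triangle instead of being split.\<close>
    using that G(6)[of "far F (\<eta> a)" "\<epsilon> (fob F a)"] triangles(1)[OF that]
    by (simp add: \<delta>_GF del: G(6))
  have "adjunction A (full_subcategory A S) (comp_functor G F) id_functor \<eta> \<delta>"
    using category_full_subcategory[OF A.category_axioms, of S] A.category_axioms
    by (auto simp: adjunction_def is_functor_def natural_transformation_def Hom_iff
        GF unit_natural triangle \<delta>_natural)
  then show ?thesis
    by (auto simp: reflective_via_def)
qed

text \<open>Dual to \<open>reflective\<close>: the inverse of the counit is the unit of the
  inclusion, and at \<open>fob F (fob G b)\<close> it is
  \<open>far F (\<eta> (fob G b))\<close>.\<close>

lemma coreflective:
  assumes FG: "\<And>b. b \<in> Ob B \<Longrightarrow> fob F (fob G b) \<in> S"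
    and inv: "\<And>b. b \<in> Ob B \<Longrightarrow> b \<in> S \<Longrightarrow> invertible B (\<epsilon> b)"
  shows "coreflective_via B (full_subcategory B S) (comp_functor F G) \<epsilon>"
proof -
  define \<delta> where "\<delta> b = B.inverse_of (\<epsilon> b)" for b
  have \<delta> [simp]: "\<delta> b \<in> Ar B" "Dom B (\<delta> b) = b" "Cod B (\<delta> b) = fob F (fob G b)"
    "Comp B (\<delta> b) (\<epsilon> b) = Ident B (fob F (fob G b))" "Comp B (\<epsilon> b) (\<delta> b) = Ident B b"
    if "b \<in> Ob B" "b \<in> S" for b
    using B.inverse_of[OF inv[OF that]] that by (auto simp: \<delta>_def)
  have \<delta>_FG: "\<delta> (fob F (fob G b)) = far F (\<eta> (fob G b))" if "b \<in> Ob B" for b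
    unfolding \<delta>_def
    by (rule B.inverse_of_eqI) (use that FG inv triangles(1) in auto)
  have \<delta>_natural: "Comp B (far F (far G f)) (\<delta> (Dom B f)) = Comp B (\<delta> (Cod B f)) f"
    if "f \<in> Ar B" "Dom B f \<in> S" "Cod B f \<in> S" for f
    unfolding \<delta>_def
    by (rule B.inverse_of_natural) (use that inv counit_natural in auto)
  have triangle: "Comp B (far F (far G (\<epsilon> b))) (\<delta> (fob F (fob G b))) = Ident B (fob F (fob G b))"
    if "b \<in> Ob B" for b
    using that F(6)[of "\<eta> (fob G b)" "far G (\<epsilon> b)"] triangles(2)[OF that]
    by (simp add: \<delta>_FG del: F(6))
  have "adjunction (full_subcategory B S) B id_functor (comp_functor F G) \<delta> \<epsilon>"
    using category_full_subcategory[OF B.category_axioms, of S] B.category_axioms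
    by (auto simp: adjunction_def is_functor_def natural_transformation_def Hom_iff
        FG counit_natural triangle \<delta>_natural)
  then show ?thesis
    by (auto simp: coreflective_via_def)
qed

end

text \<open>The universal property makes both \<open>THE\<close> descriptions well defined.
  Functoriality, naturality of the counit and one triangle are equations between arrows out of some
  \<open>F0 a\<close>, so they are compared after applying \<open>G\<close> and precomposing with
  \<eta>; the other triangle is the defining property of the counit.\<close>

lemma adjunction_of_universal_arrows:
  fixes A :: "('o, 'm) cat" and B :: "('o2, 'm2) cat"
  assumes "is_functor B A G"
    and F0 [simp]: "\<And>a. a \<in> Ob A \<Longrightarrow> F0 a \<in> Ob B"
    and \<eta>: "\<And>a. a \<in> Ob A \<Longrightarrow> \<eta> a \<in> Hom A a (fob G (F0 a))"
    and universal: "\<And>a b h. \<lbrakk>a \<in> Ob A; b \<in> Ob B; h \<in> Hom A a (fob G b)\<rbrakk>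
      \<Longrightarrow> \<exists>!k. k \<in> Hom B (F0 a) b \<and> Comp A (far G k) (\<eta> a) = h"
  shows "adjunction A B (left_adjoint_of_unit A B F0 G \<eta>) G \<eta> (counit_of_unit A B F0 G \<eta>)"
proof -
  interpret A: category A by (rule functorD(2)[OF assms(1)])
  interpret B: category B by (rule functorD(1)[OF assms(1)])
  note G [simp] = functorD(3-)[OF assms(1)]
  have \<eta> [simp]: "\<eta> a \<in> Ar A" "Dom A (\<eta> a) = a" "Cod A (\<eta> a) = fob G (F0 a)" if "a \<in> Ob A" for a
    using \<eta>[OF that] by (auto simp: Hom_iff)
  define F where "F = left_adjoint_of_unit A B F0 G \<eta>"
  define \<epsilon> where "\<epsilon> = counit_of_unit A B F0 G \<eta>"
  have [simp]: "fob F a = F0 a" for a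
    by (simp add: F_def left_adjoint_of_unit_def)
  have F_eq: "far F h = (THE k. k \<in> Hom B (F0 (Dom A h)) (F0 (Cod A h)) \<and>
      Comp A (far G k) (\<eta> (Dom A h)) = Comp A (\<eta> (Cod A h)) h)" for h
    by (simp add: F_def left_adjoint_of_unit_def)
  have F: "far F h \<in> Hom B (F0 (Dom A h)) (F0 (Cod A h)) \<and>
      Comp A (far G (far F h)) (\<eta> (Dom A h)) = Comp A (\<eta> (Cod A h)) h" if "h \<in> Ar A" for h
    unfolding F_eq by (rule theI', rule universal) (use that in \<open>auto simp: Hom_iff\<close>)
  have \<epsilon>: "\<epsilon> b \<in> Hom B (F0 (fob G b)) b \<and>
      Comp A (far G (\<epsilon> b)) (\<eta> (fob G b)) = Ident A (fob G b)" if "b \<in> Ob B" for b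
    unfolding \<epsilon>_def counit_of_unit_def
    by (rule theI', rule universal) (use that in \<open>auto simp: Hom_iff\<close>)
  have [simp]: "far F h \<in> Ar B" "Dom B (far F h) = F0 (Dom A h)" "Cod B (far F h) = F0 (Cod A h)"
    if "h \<in> Ar A" for h
    using F[OF that] by (auto simp: Hom_iff)
  have [simp]: "\<epsilon> b \<in> Ar B" "Dom B (\<epsilon> b) = F0 (fob G b)" "Cod B (\<epsilon> b) = b"
    if "b \<in> Ob B" for b
    using \<epsilon>[OF that] by (auto simp: Hom_iff)
  have unique: "k = l"
    if "a \<in> Ob A" "k \<in> Ar B" "l \<in> Ar B" "Dom B k = F0 a" "Dom B l = F0 a" "Cod B k = Cod B l"
      "Comp A (far G k) (\<eta> a) = Comp A (far G l) (\<eta> a)" for a k l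
    using universal[of a "Cod B k" "Comp A (far G k) (\<eta> a)"] that by (auto simp: Hom_iff)
  have ident: "far F (Ident A a) = Ident B (F0 a)" if "a \<in> Ob A" for a
    by (rule unique[of a]) (use that F[of "Ident A a"] in auto)
  have comp: "far F (Comp A g f) = Comp B (far F g) (far F f)"
    if fg: "f \<in> Ar A" "g \<in> Ar A" "Cod A f = Dom A g" for f g
  proof (rule unique[of "Dom A f"])
    have "Comp A (far G (Comp B (far F g) (far F f))) (\<eta> (Dom A f))
        = Comp A (far G (far F g)) (Comp A (far G (far F f)) (\<eta> (Dom A f)))"
      using fg by (simp add: A.comp_assoc)
    also have "\<dots> = Comp A (Comp A (far G (far F g)) (\<eta> (Dom A g))) f"
      using F[OF fg(1)] fg by (simp add: A.comp_assoc)
    also have "\<dots> = Comp A (\<eta> (Cod A g)) (Comp A g f)"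
      using F[OF fg(2)] fg by (simp add: A.comp_assoc)
    finally show "Comp A (far G (far F (Comp A g f))) (\<eta> (Dom A f))
        = Comp A (far G (Comp B (far F g) (far F f))) (\<eta> (Dom A f))"
      using F[of "Comp A g f"] fg by simp
  qed (use fg in auto)
  have natural: "Comp B f (\<epsilon> (Dom B f)) = Comp B (\<epsilon> (Cod B f)) (far F (far G f))"
    if f: "f \<in> Ar B" for f
  proof (rule unique[of "fob G (Dom B f)"])
    have "Comp A (far G (Comp B (\<epsilon> (Cod B f)) (far F (far G f)))) (\<eta> (fob G (Dom B f)))
        = Comp A (far G (\<epsilon> (Cod B f))) (Comp A (far G (far F (far G f))) (\<eta> (fob G (Dom B f))))"
      using f by (simp add: A.comp_assoc)
    also have "\<dots> = Comp A (Comp A (far G (\<epsilon> (Cod B f))) (\<eta> (fob G (Cod B f)))) (far G f)"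
      using F[of "far G f"] f by (simp add: A.comp_assoc)
    also have "\<dots> = far G f"
      using \<epsilon>[of "Cod B f"] f by simp
    finally show "Comp A (far G (Comp B f (\<epsilon> (Dom B f)))) (\<eta> (fob G (Dom B f)))
        = Comp A (far G (Comp B (\<epsilon> (Cod B f)) (far F (far G f)))) (\<eta> (fob G (Dom B f)))"
      using \<epsilon>[of "Dom B f"] f by (simp add: A.comp_assoc)
  qed (use f in auto)
  have triangle: "Comp B (\<epsilon> (F0 a)) (far F (\<eta> a)) = Ident B (F0 a)" if a: "a \<in> Ob A" for a
  proof (rule unique[of a])
    have "Comp A (far G (Comp B (\<epsilon> (F0 a)) (far F (\<eta> a)))) (\<eta> a)
        = Comp A (far G (\<epsilon> (F0 a))) (Comp A (far G (far F (\<eta> a))) (\<eta> a))"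
      using a by (simp add: A.comp_assoc)
    also have "\<dots> = Comp A (Comp A (far G (\<epsilon> (F0 a))) (\<eta> (fob G (F0 a)))) (\<eta> a)"
      using F[of "\<eta> a"] a by (simp add: A.comp_assoc)
    finally show "Comp A (far G (Comp B (\<epsilon> (F0 a)) (far F (\<eta> a)))) (\<eta> a)
        = Comp A (far G (Ident B (F0 a))) (\<eta> a)"
      using \<epsilon>[of "F0 a"] a by simp
  qed (use a in auto)
  have "adjunction A B F G \<eta> \<epsilon>"
    using assms(1) A.category_axioms B.category_axioms F \<epsilon>
    by (auto simp: adjunction_def is_functor_def[of A B F] natural_transformation_def Hom_iff
        ident comp natural triangle)
  then show ?thesis
    by (simp add: F_def \<epsilon>_def)
qed

section \<open>Joins in restriction categories\<close>

context restriction_category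
begin

lemma rst_arrow [simp]:
  assumes "f \<in> Ar C"
  shows "Rst C f \<in> Ar C" "Dom C (Rst C f) = Dom C f" "Cod C (Rst C f) = Dom C f"
  using Rst_Hom[of f "Dom C f" "Cod C f"] assms by (auto simp: Hom_iff)

lemma comp_rst [simp]: "f \<in> Ar C \<Longrightarrow> f \<cdot> Rst C f = f"
  using Comp_Rst[of f "Dom C f" "Cod C f"] by (auto simp: Hom_iff)

lemma rst_commute:
  "f \<in> Ar C \<Longrightarrow> g \<in> Ar C \<Longrightarrow> Dom C f = Dom C g \<Longrightarrow> Rst C f \<cdot> Rst C g = Rst C g \<cdot> Rst C f"
  using Rst_commute[of f "Dom C f" "Cod C f" g "Cod C g"] by (auto simp: Hom_iff)

lemma rst_comp_rst [simp]:
  "f \<in> Ar C \<Longrightarrow> g \<in> Ar C \<Longrightarrow> Dom C f = Dom C g \<Longrightarrow> Rst C (g \<cdot> Rst C f) = Rst C g \<cdot> Rst C f"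
  using Rst_Comp_Rst[of f "Dom C f" "Cod C f" g "Cod C g"] by (auto simp: Hom_iff)

lemma rst_comp:
  "f \<in> Ar C \<Longrightarrow> g \<in> Ar C \<Longrightarrow> Dom C g = Cod C f \<Longrightarrow> Rst C g \<cdot> f = f \<cdot> Rst C (g \<cdot> f)"
  using Rst_Comp[of f "Dom C f" "Cod C f" g "Cod C g"] by (auto simp: Hom_iff)

lemma rst_ident [simp]: "A \<in> Ob C \<Longrightarrow> Rst C (Ident C A) = Ident C A"
  using comp_rst[of "Ident C A"] by (simp del: comp_rst)

lemma rst_rst [simp]: "f \<in> Ar C \<Longrightarrow> Rst C (Rst C f) = Rst C f"
  using rst_comp_rst[of f "Ident C (Dom C f)"] by (simp del: rst_comp_rst)

lemma rst_idem [simp]: "f \<in> Ar C \<Longrightarrow> Rst C f \<cdot> Rst C f = Rst C f"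
  using rst_comp_rst[of f f] by simp

lemma rst_comp_absorb:
  assumes "f \<in> Ar C" "g \<in> Ar C" "Dom C g = Cod C f"
  shows "Rst C (g \<cdot> f) \<cdot> Rst C f = Rst C (g \<cdot> f)"
proof -
  have "Rst C (g \<cdot> f) \<cdot> Rst C f = Rst C ((g \<cdot> f) \<cdot> Rst C f)"
    using assms by (intro rst_comp_rst[symmetric]) auto
  then show ?thesis
    using assms by (simp add: comp_assoc)
qed

lemma rst_rst_comp:
  assumes "f \<in> Ar C" "g \<in> Ar C" "Dom C g = Cod C f"
  shows "Rst C (Rst C g \<cdot> f) = Rst C (g \<cdot> f)"
  unfolding rst_comp[OF assms]
  using assms rst_comp_absorb[OF assms] rst_commute[of f "g \<cdot> f"] by simp

lemma rst_total_comp: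
  assumes "total_map C g" "f \<in> Ar C" "Dom C g = Cod C f"
  shows "Rst C (g \<cdot> f) = Rst C f"
  using assms rst_rst_comp[of f g] by (simp add: total_map_def)

lemma rest_idem_iff:
  "e \<in> rest_idem C A \<longleftrightarrow> e \<in> Ar C \<and> Dom C e = A \<and> Cod C e = A \<and> Rst C e = e"
  by (auto simp: rest_idem_def Hom_iff)

lemma rest_idem_arrow:
  assumes "e \<in> rest_idem C A"
  shows "e \<in> Ar C" "Dom C e = A" "Cod C e = A" "Rst C e = e" "e \<cdot> e = e"
  using assms rst_idem[of e] by (auto simp: rest_idem_iff simp del: rst_idem)

lemma rst_rest_idem [simp]: "f \<in> Ar C \<Longrightarrow> Dom C f = A \<Longrightarrow> Rst C f \<in> rest_idem C A"
  by (auto simp: rest_idem_iff)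

lemma rest_idem_commute: "e \<in> rest_idem C A \<Longrightarrow> d \<in> rest_idem C A \<Longrightarrow> e \<cdot> d = d \<cdot> e"
  using rst_commute[of e d] by (simp add: rest_idem_iff)

lemma rst_comp_rest_idem [simp]:
  "e \<in> rest_idem C (Dom C f) \<Longrightarrow> f \<in> Ar C \<Longrightarrow> Rst C (f \<cdot> e) = Rst C f \<cdot> e"
  using rst_comp_rst[of e f] by (simp add: rest_idem_iff)

lemma rest_idem_comp [simp]: "e \<in> rest_idem C A \<Longrightarrow> d \<in> rest_idem C A \<Longrightarrow> e \<cdot> d \<in> rest_idem C A"
  using rst_comp_rst[of d e] by (auto simp: rest_idem_iff)

lemma ident_rest_idem [simp]: "A \<in> Ob C \<Longrightarrow> Ident C A \<in> rest_idem C A"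
  by (auto simp: rest_idem_iff)

lemma rest_idem_left_commute:
  assumes "e \<in> rest_idem C A" "d \<in> rest_idem C A" "c \<in> rest_idem C A"
  shows "e \<cdot> (d \<cdot> c) = d \<cdot> (e \<cdot> c)"
proof -
  note [simp] = rest_idem_arrow[OF assms(1)] rest_idem_arrow[OF assms(2)] rest_idem_arrow[OF assms(3)]
  have "e \<cdot> (d \<cdot> c) = (e \<cdot> d) \<cdot> c" by (simp add: comp_assoc)
  also have "\<dots> = d \<cdot> (e \<cdot> c)"
    by (simp add: rest_idem_commute[OF assms(1,2)] comp_assoc)
  finally show ?thesis .
qed

lemma rest_idem_left_idem [simp]:
  assumes "e \<in> rest_idem C (Cod C f)" "f \<in> Ar C"
  shows "e \<cdot> (e \<cdot> f) = e \<cdot> f"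
  using assms rest_idem_arrow[OF assms(1)] comp_assoc[of f e e] by simp

lemma rleD:
  assumes "rle C f g"
  shows "f \<in> Ar C" "g \<in> Ar C" "Dom C f = Dom C g" "Cod C f = Cod C g" "g \<cdot> Rst C f = f"
  using assms by (auto simp: rle_def parallel_def)

lemma rleI:
  "\<lbrakk>f \<in> Ar C; g \<in> Ar C; Dom C f = Dom C g; Cod C f = Cod C g; g \<cdot> Rst C f = f\<rbrakk> \<Longrightarrow> rle C f g"
  by (auto simp: rle_def parallel_def)

lemma rle_comp_rest_idem:
  assumes "f \<in> Ar C" "e \<in> rest_idem C A" "Dom C f = A"
  shows "rle C (f \<cdot> e) f"
  using assms rest_idem_arrow[OF assms(2)] comp_assoc[of e "Rst C f" f]
  by (auto intro!: rleI)

lemma rle_rest_idem_iff: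
  assumes "e \<in> rest_idem C A" "d \<in> rest_idem C A"
  shows "rle C e d \<longleftrightarrow> e \<cdot> d = e"
  using rest_idem_arrow[OF assms(1)] rest_idem_arrow[OF assms(2)] rest_idem_commute[OF assms]
  by (auto intro!: rleI dest: rleD)

lemma rle_antisym: "rle C f g \<Longrightarrow> rle C g f \<Longrightarrow> f = g"
proof -
  assume f: "rle C f g" and g: "rle C g f"
  note [simp] = rleD(1-4)[OF f]
  have "f = g \<cdot> Rst C f" using rleD(5)[OF f] by simp
  also have "\<dots> = (f \<cdot> Rst C g) \<cdot> Rst C f" using rleD(5)[OF g] by simp
  also have "\<dots> = f \<cdot> (Rst C g \<cdot> Rst C f)" by (simp add: comp_assoc)
  also have "\<dots> = f \<cdot> (Rst C f \<cdot> Rst C g)" using rst_commute[of f g] by simp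
  also have "\<dots> = (f \<cdot> Rst C f) \<cdot> Rst C g" by (intro comp_assoc[symmetric]) auto
  also have "\<dots> = g" using rleD(5)[OF g] by simp
  finally show ?thesis .
qed

text \<open>Both maps are restrictions of \<open>h\<close>, and restriction idempotents commute.
  This discharges the compatibility hypothesis of the join axioms for any family with an upper
  bound.\<close>

lemma compatible_if_bounded:
  assumes f: "rle C f h" and g: "rle C g h"
  shows "compatible C f g"
proof -
  note [simp] = rleD(1-4)[OF f] rleD(1-4)[OF g]
  have "f \<cdot> Rst C g = (h \<cdot> Rst C f) \<cdot> Rst C g" by (simp add: rleD(5)[OF f])
  also have "\<dots> = h \<cdot> (Rst C f \<cdot> Rst C g)" by (intro comp_assoc) auto
  also have "\<dots> = h \<cdot> (Rst C g \<cdot> Rst C f)" using rst_commute[of f g] by simp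
  also have "\<dots> = (h \<cdot> Rst C g) \<cdot> Rst C f" by (intro comp_assoc[symmetric]) auto
  finally show ?thesis
    by (simp add: compatible_def parallel_def rleD(5)[OF g])
qed

lemma is_joinD:
  assumes "is_join (rle C) (Hom C A B) F h"
  shows "h \<in> Ar C" "Dom C h = A" "Cod C h = B" "\<And>t. t \<in> F \<Longrightarrow> rle C t h"
    "\<And>k. \<lbrakk>k \<in> Hom C A B; \<And>t. t \<in> F \<Longrightarrow> rle C t k\<rbrakk> \<Longrightarrow> rle C h k"
  using assms by (auto simp: is_join_def Hom_iff)

text \<open>\<open>h \<cdot> e\<close> is still an upper bound of \<open>F\<close>, because
  \<open>e\<close> contains the domain of each member, so minimality gives
  \<open>h = h \<cdot> e\<close>. In effect the domain of a join is the join of the domains.\<close>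

lemma join_rst_le:
  assumes h: "is_join (rle C) (Hom C A B) F h" and e: "e \<in> rest_idem C A"
    and F: "\<And>t. t \<in> F \<Longrightarrow> Rst C t \<cdot> e = Rst C t"
  shows "Rst C h \<cdot> e = Rst C h"
proof -
  note [simp] = is_joinD(1-3)[OF h] e rest_idem_arrow[OF e]
  have "rle C t (h \<cdot> e)" if t: "t \<in> F" for t
  proof -
    note t' = rleD[OF is_joinD(4)[OF h t]]
    have [simp]: "t \<in> Ar C" "Dom C t = A" "Cod C t = B" using t' by auto
    have "(h \<cdot> e) \<cdot> Rst C t = h \<cdot> (Rst C t \<cdot> e)"
      by (simp add: comp_assoc rest_idem_commute[OF e])
    then show ?thesis
      using t' by (intro rleI) (auto simp: F[OF t])
  qed
  then have "rle C h (h \<cdot> e)"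
    by (intro is_joinD(5)[OF h]) (auto simp: Hom_iff)
  moreover have "rle C (h \<cdot> e) h"
    by (rule rle_comp_rest_idem) auto
  ultimately have "h \<cdot> e = h" by (rule rle_antisym[symmetric])
  then show ?thesis using rst_comp_rest_idem[of e h] by simp
qed

end

context join_restriction_category
begin

lemma bounded_join:
  assumes "\<And>t. t \<in> F \<Longrightarrow> rle C t k" "k \<in> Hom C A B"
  shows "\<exists>h. is_join (rle C) (Hom C A B) F h \<and> rle C h k"
proof -
  have [simp]: "k \<in> Ar C" "Dom C k = A" "Cod C k = B" using assms by (auto simp: Hom_iff)
  have "F \<subseteq> Hom C A B" using rleD[OF assms(1)] by (auto simp: Hom_iff)
  then obtain h where h: "is_join (rle C) (Hom C A B) F h"
    using join_exists[of A B F] assms(1) Dom_Ob[of k] Cod_Ob[of k]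
    by (auto intro: compatible_if_bounded)
  with is_joinD(5)[OF h] assms show ?thesis by blast
qed

lemma bounded_join_precomp:
  assumes h: "is_join (rle C) (Hom C A B) F h" and g: "g \<in> Hom C Z A"
  shows "is_join (rle C) (Hom C Z B) ((\<lambda>t. t \<cdot> g) ` F) (h \<cdot> g)"
proof (rule join_precomp[OF _ _ _ _ h g])
  show "A \<in> Ob C" "B \<in> Ob C"
    using is_joinD(1-3)[OF h] by auto
  show "F \<subseteq> Hom C A B"
    using is_joinD(1-3)[OF h] rleD[OF is_joinD(4)[OF h]] by (auto simp: Hom_iff)
  show "\<forall>f \<in> F. \<forall>g \<in> F. compatible C f g"
    using is_joinD(4)[OF h] by (auto intro: compatible_if_bounded)
qed

text \<open>The counterpart for postcomposition of the join axiom: \<open>f \<cdot> Rst C h\<close>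
  and \<open>g \<cdot> Rst C h\<close> both equal the join \<open>k\<close> of the common
  restrictions \<open>f \<cdot> Rst C t\<close>. That \<open>k\<close> lies below them is clear;
  equality comes from comparing domains.\<close>

lemma eq_on_join:
  assumes h: "is_join (rle C) (Hom C A B) F h"
    and f: "f \<in> Hom C A D" and g: "g \<in> Hom C A D"
    and eq: "\<And>t. t \<in> F \<Longrightarrow> f \<cdot> Rst C t = g \<cdot> Rst C t"
  shows "f \<cdot> Rst C h = g \<cdot> Rst C h"
proof -
  have [simp]: "h \<in> Ar C" "Dom C h = A" "Cod C h = B" using is_joinD[OF h] by auto
  have t [simp]: "t \<in> Ar C" "Dom C t = A" "Cod C t = B" "Rst C t \<cdot> Rst C h = Rst C t"
    "Rst C h \<cdot> Rst C t = Rst C t"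
    if "t \<in> F" for t
  proof -
    note t' = rleD[OF is_joinD(4)[OF h that]]
    show [simp]: "t \<in> Ar C" "Dom C t = A" "Cod C t = B" using t' by auto
    show "Rst C h \<cdot> Rst C t = Rst C t" using arg_cong[OF t'(5), of "Rst C"] by simp
    then show "Rst C t \<cdot> Rst C h = Rst C t" using rst_commute[of t h] by simp
  qed
  have below: "rle C (f' \<cdot> Rst C t) (f' \<cdot> Rst C h)"
    if "f' \<in> Hom C A D" "t \<in> F" for f' t
  proof -
    have "f' \<cdot> Rst C t = (f' \<cdot> Rst C h) \<cdot> Rst C t"
      using that by (simp add: Hom_iff comp_assoc)
    also have "rle C \<dots> (f' \<cdot> Rst C h)"
      using that by (intro rle_comp_rest_idem[of _ _ A]) (auto simp: Hom_iff)
    finally show ?thesis .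
  qed
  obtain k where k: "is_join (rle C) (Hom C A D) ((\<lambda>t. f \<cdot> Rst C t) ` F) k"
    and kf: "rle C k (f \<cdot> Rst C h)"
    using bounded_join[of "(\<lambda>t. f \<cdot> Rst C t) ` F" "f \<cdot> Rst C h" A D] below[OF f] f
    by (auto simp: Hom_iff)
  have kg: "rle C k (g \<cdot> Rst C h)"
    using is_joinD(5)[OF k, of "g \<cdot> Rst C h"] below[OF g] g by (auto simp: Hom_iff eq)
  have [simp]: "k \<in> Ar C" "Dom C k = A" "Cod C k = D" using is_joinD[OF k] by auto
  \<comment> \<open>Stated for a variable \<open>f'\<close> since it is applied to \<open>f\<close>
    and to \<open>g\<close>. As \<open>k\<close> is a restriction of
    \<open>f' \<cdot> Rst C h\<close>, only an inclusion of domains is at stake.\<close>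
  have "f' \<cdot> Rst C h = k"
    if f': "f' \<in> Hom C A D" and kf': "rle C k (f' \<cdot> Rst C h)"
      and le: "\<And>t. t \<in> F \<Longrightarrow> rle C (f' \<cdot> Rst C t) k" for f'
  proof -
    have [simp]: "f' \<in> Ar C" "Dom C f' = A" "Cod C f' = D" using f' by (auto simp: Hom_iff)
    \<comment> \<open>The domain of \<open>f' \<cdot> Rst C h\<close> is that of
      \<open>h \<cdot> Rst C f'\<close>, a join of the maps \<open>t \<cdot> Rst C f'\<close>, and
      so within reach of \<open>join_rst_le\<close>.\<close>
    note j = bounded_join_precomp[OF h, of "Rst C f'" A]
    have "Rst C (h \<cdot> Rst C f') \<cdot> Rst C k = Rst C (h \<cdot> Rst C f')"
    proof (rule join_rst_le[OF j])
      fix t assume "t \<in> (\<lambda>t. t \<cdot> Rst C f') ` F"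
      then obtain t' where t': "t' \<in> F" and [simp]: "t = t' \<cdot> Rst C f'" by auto
      have comm: "Rst C t' \<cdot> Rst C f' = Rst C f' \<cdot> Rst C t'"
        using t' rst_commute[of t' f'] by simp
      have "Rst C k \<cdot> (Rst C f' \<cdot> Rst C t') = Rst C f' \<cdot> Rst C t'"
        using arg_cong[OF rleD(5)[OF le[OF t']], of "Rst C"] t' by simp
      then show "Rst C t \<cdot> Rst C k = Rst C t"
        using t' rest_idem_commute[of "Rst C k" A "Rst C f' \<cdot> Rst C t'"] by (simp add: comm)
    qed (auto simp: Hom_iff)
    then have r: "(Rst C f' \<cdot> Rst C h) \<cdot> Rst C k = Rst C f' \<cdot> Rst C h"
      using rst_commute[of f' h] by simp
    have "k = (f' \<cdot> Rst C h) \<cdot> Rst C k" using rleD(5)[OF kf'] by simp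
    also have "\<dots> = f' \<cdot> ((Rst C f' \<cdot> Rst C h) \<cdot> Rst C k)"
      by (simp add: comp_assoc[symmetric])
    also have "\<dots> = f' \<cdot> Rst C h" unfolding r by (simp add: comp_assoc[symmetric])
    finally show ?thesis ..
  qed
  from this[OF f kf] this[OF g kg] is_joinD(4)[OF k] show ?thesis by (force simp: eq)
qed

lemma eq_of_join_total:
  assumes h: "is_join (rle C) (Hom C A B) F h" and "total_map C h"
    and "f \<in> Hom C A D" "g \<in> Hom C A D"
    and "\<And>t. t \<in> F \<Longrightarrow> f \<cdot> Rst C t = g \<cdot> Rst C t"
  shows "f = g"
  using eq_on_join[OF h assms(3-5)] assms(2-4) is_joinD(2)[OF h] by (simp add: total_map_def Hom_iff)

end

text \<open>Common setting for the chosen glueing of a presheaf and for an arbitrary local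
  homeomorphism. No atlas is part of the data: the overlaps are recovered as
  \<open>P j \<cdot> s i\<close>.\<close>

locale cover = join_restriction_category C
  for C :: "('o, 'm, 'z) rcat_scheme" (structure) +
  fixes p and P s :: "'i \<Rightarrow> 'm" and I :: "'i set"
  assumes total: "total_map C p"
    and join: "is_join (rle C) (Hom C (Dom C p) (Cod C p)) (P ` I) p"
    and inverses: "i \<in> I \<Longrightarrow> partial_inverse C (P i) (s i)"
begin

lemma cover_map [simp]: "p \<in> Ar C" "Rst C p = Ident C (Dom C p)"
  using total by (auto simp: total_map_def)

lemma chart [simp]:
  assumes "i \<in> I"
  shows "P i \<in> Ar C" "Dom C (P i) = Dom C p" "Cod C (P i) = Cod C p" "p \<cdot> Rst C (P i) = P i"
  using rleD[OF is_joinD(4)[OF join]] assms by auto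

lemma sect [simp]:
  assumes "i \<in> I"
  shows "s i \<in> Ar C" "Dom C (s i) = Cod C p" "Cod C (s i) = Dom C p"
    "s i \<cdot> P i = Rst C (P i)" "P i \<cdot> s i = Rst C (s i)"
  using inverses[OF assms] chart[OF assms] by (auto simp: partial_inverse_def Hom_iff)

lemma chart_comp:
  assumes i: "i \<in> I" and x: "x \<in> Ar C" "Cod C x = Dom C p"
  shows "P i \<cdot> x = (p \<cdot> x) \<cdot> Rst C (P i \<cdot> x)"
proof -
  have "P i \<cdot> x = p \<cdot> (Rst C (P i) \<cdot> x)"
    using i x by (simp add: comp_assoc[symmetric])
  then show ?thesis
    using i x rst_comp[of x "P i"] by (simp add: comp_assoc)
qed

text \<open>\<open>P i \<cdot> x\<close> is the part of the domain of \<open>x\<close> on which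
  \<open>x\<close> takes values in chart \<open>i\<close>. It is idempotent because
  \<open>P i\<close> is a restriction of \<open>p\<close>, and \<open>p \<cdot> x\<close> is a
  restriction idempotent. On it \<open>x\<close> coincides with \<open>s i\<close>, since
  \<open>s i \<cdot> P i\<close> is the domain of the chart.\<close>

lemma chart_partial_section:
  assumes i: "i \<in> I" and "partial_section C p x"
  shows "P i \<cdot> x \<in> rest_idem C (Cod C p)" "P i \<cdot> x \<cdot> Rst C x = P i \<cdot> x"
    "x \<cdot> (P i \<cdot> x) = s i \<cdot> (P i \<cdot> x)"
proof -
  have x [simp]: "x \<in> Ar C" "Dom C x = Cod C p" "Cod C x = Dom C p" "p \<cdot> x = Rst C x"
    using assms(2) by (auto simp: partial_section_def Hom_iff)
  have "P i \<cdot> x = Rst C x \<cdot> Rst C (P i \<cdot> x)"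
    by (rule trans[OF chart_comp[OF i]]) auto
  also have "\<dots> = Rst C (P i \<cdot> x)"
    using i rst_comp_absorb[of x "P i"] rst_commute[of x "P i \<cdot> x"] by simp
  finally have e: "Rst C (P i \<cdot> x) = P i \<cdot> x" by (rule sym)
  then show *: "P i \<cdot> x \<in> rest_idem C (Cod C p)"
    using i by (simp add: rest_idem_iff)
  show "P i \<cdot> x \<cdot> Rst C x = P i \<cdot> x"
    using i by (simp add: comp_assoc)
  have "x \<cdot> (P i \<cdot> x) = Rst C (P i) \<cdot> x"
    using i e rst_comp[of x "P i"] by simp
  also have "\<dots> = s i \<cdot> (P i \<cdot> x)"
    using i by (simp flip: comp_assoc)
  finally show "x \<cdot> (P i \<cdot> x) = s i \<cdot> (P i \<cdot> x)" .
qed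

lemma sect_partial_section: "i \<in> I \<Longrightarrow> partial_section C p (s i)"
  using chart_comp[of i "s i", symmetric] by (simp add: partial_section_def Hom_iff comp_assoc)

text \<open>Precomposing the join \<open>p\<close> of the charts with \<open>x\<close> shows
  \<open>Rst C x\<close> to be the join of the idempotents \<open>P i \<cdot> x\<close>, so these
  cover the domain of \<open>x\<close>.\<close>

lemma eq_on_partial_section:
  assumes x: "partial_section C p x" and fg: "f \<in> Hom C (Cod C p) D" "g \<in> Hom C (Cod C p) D"
    and eq: "\<And>i. i \<in> I \<Longrightarrow> f \<cdot> (P i \<cdot> x) = g \<cdot> (P i \<cdot> x)"
  shows "f \<cdot> Rst C x = g \<cdot> Rst C x"
proof -
  have x' [simp]: "x \<in> Ar C" "Dom C x = Cod C p" "Cod C x = Dom C p" "p \<cdot> x = Rst C x"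
    using x by (auto simp: partial_section_def Hom_iff)
  have "is_join (rle C) (Hom C (Cod C p) (Cod C p)) ((\<lambda>t. t \<cdot> x) ` (P ` I)) (p \<cdot> x)"
    by (rule bounded_join_precomp[OF join]) (simp add: Hom_iff)
  then have "f \<cdot> Rst C (p \<cdot> x) = g \<cdot> Rst C (p \<cdot> x)"
  proof (rule eq_on_join[OF _ fg])
    fix t assume "t \<in> (\<lambda>t. t \<cdot> x) ` (P ` I)"
    then obtain i where "i \<in> I" "t = P i \<cdot> x" by auto
    then show "f \<cdot> Rst C t = g \<cdot> Rst C t"
      using eq chart_partial_section(1)[OF _ x] by (simp add: rest_idem_iff)
  qed
  then show ?thesis by simp
qed

text \<open>The sections are jointly epic: \<open>Rst C (P i) = s i \<cdot> P i\<close>, and the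
  domains of the charts cover because \<open>p\<close> is total.\<close>

lemma maps_eqI:
  assumes "k \<in> Hom C (Dom C p) D" "l \<in> Hom C (Dom C p) D"
    and "\<And>i. i \<in> I \<Longrightarrow> k \<cdot> s i = l \<cdot> s i"
  shows "k = l"
proof (rule eq_of_join_total[OF join total assms(1,2)])
  fix t assume "t \<in> P ` I"
  then obtain i where i: "i \<in> I" and [simp]: "t = P i" by auto
  have "k \<cdot> (s i \<cdot> P i) = l \<cdot> (s i \<cdot> P i)"
    using i assms by (simp add: Hom_iff comp_assoc[symmetric] del: sect(4))
  then show "k \<cdot> Rst C t = l \<cdot> Rst C t"
    using i by simp
qed

text \<open>The map is the join of the \<open>g i \<cdot> P i\<close>. Equal extents of
  \<open>g i\<close> and \<open>s i\<close> make the domain of \<open>g i \<cdot> P i\<close> the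
  whole chart, and agreement on the idempotents \<open>P j \<cdot> s i\<close> of the base yields
  compatibility upstairs.\<close>

lemma glue_maps:
  assumes q: "total_map C q" "Cod C q = Cod C p"
    and g: "\<And>i. i \<in> I \<Longrightarrow> partial_section C q (g i)" "\<And>i. i \<in> I \<Longrightarrow> Rst C (g i) = Rst C (s i)"
    and agree: "\<And>i j. \<lbrakk>i \<in> I; j \<in> I\<rbrakk> \<Longrightarrow> g i \<cdot> (P j \<cdot> s i) = g j \<cdot> (P j \<cdot> s i)"
  shows "\<exists>k \<in> Hom C (Dom C p) (Dom C q). q \<cdot> k = p \<and> (\<forall>i \<in> I. k \<cdot> s i = g i)"
proof -
  have [simp]: "q \<in> Ar C" "Cod C q = Cod C p" using q by (auto simp: total_map_def)
  have g' [simp]: "g i \<in> Ar C" "Dom C (g i) = Cod C p" "Cod C (g i) = Dom C q"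
    "q \<cdot> g i = Rst C (s i)" if "i \<in> I" for i
    using g[OF that] by (auto simp: partial_section_def Hom_iff)
  have sP [simp]: "Rst C (s i) \<cdot> P i = P i" if "i \<in> I" for i
    using that sect(5)[OF that] comp_assoc[of "P i" "s i" "P i"] by simp
  have rst [simp]: "Rst C (g i \<cdot> P i) = Rst C (P i)" if i: "i \<in> I" for i
    using i rst_rst_comp[of "P i" "g i"] g(2) by simp
  have overlap: "P j \<cdot> s i \<in> rest_idem C (Cod C p)" if "i \<in> I" "j \<in> I" for i j
    using chart_partial_section(1)[OF that(2) sect_partial_section[OF that(1)]] .
  \<comment> \<open>On the overlap of their domains \<open>P i\<close> and \<open>P j\<close>
    coincide, and \<open>Rst C (P i) = s i \<cdot> P i\<close> brings in the base idempotent
    \<open>P j \<cdot> s i\<close>, where \<open>agree\<close> applies. In view of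
    \<open>rst\<close> this is the compatibility condition.\<close>
  have le: "(g i \<cdot> P i) \<cdot> Rst C (P j) = (g j \<cdot> P j) \<cdot> Rst C (P i)" if i: "i \<in> I" and j: "j \<in> I" for i j
  proof -
    have PP: "P i \<cdot> Rst C (P j) = P j \<cdot> Rst C (P i)"
      using compatible_if_bounded[OF is_joinD(4)[OF join] is_joinD(4)[OF join]] i j
      by (auto simp: compatible_def)
    have "(g i \<cdot> P i) \<cdot> Rst C (P j) = g i \<cdot> (P j \<cdot> Rst C (P i))"
      using i j by (simp add: comp_assoc PP)
    also have "\<dots> = (g i \<cdot> (P j \<cdot> s i)) \<cdot> P i"
      using i j by (simp add: comp_assoc)
    also have "\<dots> = (g j \<cdot> (P j \<cdot> s i)) \<cdot> P i"
      by (simp only: agree[OF i j])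
    also have "\<dots> = (g j \<cdot> P j) \<cdot> Rst C (P i)"
      using i j by (simp add: comp_assoc)
    finally show ?thesis .
  qed
  have "compatible C (g i \<cdot> P i) (g j \<cdot> P j)" if "i \<in> I" "j \<in> I" for i j
    using le[OF that] that by (simp add: compatible_def parallel_def)
  then obtain k where k: "is_join (rle C) (Hom C (Dom C p) (Dom C q)) ((\<lambda>i. g i \<cdot> P i) ` I) k"
    using join_exists[of "Dom C p" "Dom C q" "(\<lambda>i. g i \<cdot> P i) ` I"]
    by (force simp: Hom_iff)
  have k' [simp]: "k \<in> Ar C" "Dom C k = Dom C p" "Cod C k = Dom C q" using is_joinD[OF k] by auto
  have kP: "k \<cdot> Rst C (P i) = g i \<cdot> P i" if "i \<in> I" for i
    using rleD(5)[OF is_joinD(4)[OF k, of "g i \<cdot> P i"]] that by simp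
  have "k \<cdot> s i = g i" if i: "i \<in> I" for i
  proof -
    \<comment> \<open>Inserting \<open>P i\<close> moves the question onto the chart, where
      \<open>k\<close> is known by \<open>kP\<close>.\<close>
    have "k \<cdot> s i = k \<cdot> (s i \<cdot> (P i \<cdot> s i))"
      using i by simp
    also have "\<dots> = (k \<cdot> (s i \<cdot> P i)) \<cdot> s i"
      using i by (simp add: comp_assoc del: sect(4,5))
    also have "\<dots> = g i \<cdot> Rst C (s i)"
      using i by (simp add: kP comp_assoc)
    also have "\<dots> = g i"
      using i comp_rst[of "g i"] by (simp add: g(2) del: comp_rst)
    finally show ?thesis .
  qed
  moreover have "q \<cdot> k = p"
  proof (rule eq_of_join_total[OF join total])
    fix t assume "t \<in> P ` I"
    then obtain i where i: "i \<in> I" and [simp]: "t = P i" by auto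
    \<comment> \<open>Here \<open>q \<cdot> g i\<close> is \<open>Rst C (s i)\<close>, which fixes
      \<open>P i\<close> by \<open>sP\<close>; the restriction of \<open>p\<close> is
      \<open>P i\<close> as well.\<close>
    have "(q \<cdot> k) \<cdot> Rst C t = (q \<cdot> g i) \<cdot> P i"
      using i by (simp add: comp_assoc kP del: g'(4))
    then show "(q \<cdot> k) \<cdot> Rst C t = p \<cdot> Rst C t"
      using i by simp
  qed (auto simp: Hom_iff)
  ultimately show ?thesis
    by (intro bexI[of _ k]) (simp_all add: Hom_iff)
qed

end

section \<open>Presheaves and partial sections\<close>

lemma partial_section_iff:
  "partial_section C p s \<longleftrightarrow>
    s \<in> Ar C \<and> Dom C s = Cod C p \<and> Cod C s = Dom C p \<and> Comp C p s = Rst C s"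
  by (auto simp: partial_section_def Hom_iff)

lemma slice_t_sel [simp]:
  "p \<in> Ob (slice_t C X) \<longleftrightarrow> total_map C p \<and> Cod C p = X"
  "Dom (slice_t C X) (p, f, q) = p" "Cod (slice_t C X) (p, f, q) = q"
  "Ident (slice_t C X) p = (p, Ident C (Dom C p), p)"
  "Comp (slice_t C X) (q', g, r) (p, f, q) = (p, Comp C g f, r)"
  "(p, f, q) \<in> Ar (slice_t C X) \<longleftrightarrow> total_map C p \<and> total_map C q \<and> Cod C p = X \<and> Cod C q = X \<and>
     f \<in> Ar C \<and> Dom C f = Dom C p \<and> Cod C f = Dom C q \<and> Comp C q f = p"
  by (auto simp: slice_t_def Let_def Hom_iff total_map_def)

lemma Psh_sel [simp]:
  "A \<in> Ob (Psh C X) \<longleftrightarrow> is_presheaf C X A \<and> small (elts A)"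
  "Dom (Psh C X) (A, h, B) = A" "Cod (Psh C X) (A, h, B) = B"
  "Ident (Psh C X) A = (A, \<lambda>a \<in> elts A. a, A)"
  "Comp (Psh C X) (B', k, D) (A, h, B) = (A, compose (elts A) k h, D)"
  "(A, h, B) \<in> Ar (Psh C X) \<longleftrightarrow> is_presheaf C X A \<and> small (elts A) \<and>
     is_presheaf C X B \<and> small (elts B) \<and> presheaf_map C X A B h"
  by (auto simp: Psh_def Let_def)

lemma Gamma_sel [simp]:
  "fob (Gamma C) p = Gamma_ob C p"
  "far (Gamma C) (p, f, q) =
     (Gamma_ob C p, \<lambda>s \<in> {s. partial_section C p s}. Comp C f s, Gamma_ob C q)"
  "elts (Gamma_ob C p) = {s. partial_section C p s}"
  "action (Gamma_ob C p) s e = Comp C s e" "extent (Gamma_ob C p) s = Rst C s"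
  by (simp_all add: Gamma_def Gamma_ob_def)

lemma presheaf_mapD:
  assumes "presheaf_map C X A B h"
  shows "h \<in> extensional (elts A)" "\<And>a. a \<in> elts A \<Longrightarrow> h a \<in> elts B"
    "\<And>a e. a \<in> elts A \<Longrightarrow> e \<in> rest_idem C X \<Longrightarrow> h (action A a e) = action B (h a) e"
    "\<And>a. a \<in> elts A \<Longrightarrow> extent B (h a) = extent A a"
  using assms by (auto simp: presheaf_map_def PiE_def Pi_def)

lemma is_presheafD:
  assumes "is_presheaf C X A" "a \<in> elts A"
  shows "e \<in> rest_idem C X \<Longrightarrow> action A a e \<in> elts A"
    "action A a (Ident C X) = a"
    "e \<in> rest_idem C X \<Longrightarrow> e' \<in> rest_idem C X
      \<Longrightarrow> action A (action A a e) e' = action A a (Comp C e e')"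
    "extent A a \<in> rest_idem C X" "action A a (extent A a) = a"
    "e \<in> rest_idem C X \<Longrightarrow> extent A (action A a e) = Comp C (extent A a) e"
  using assms by (auto simp: is_presheaf_def)

lemma presheaf_map_compose:
  assumes "is_presheaf C X A" "presheaf_map C X A B h" "presheaf_map C X B D k"
  shows "presheaf_map C X A D (compose (elts A) k h)"
  using assms by (auto simp: presheaf_map_def compose_def is_presheaf_def PiE_def Pi_def)

lemma category_Psh: "category (Psh C X)"
proof
  show "Ident (Psh C X) A \<in> Hom (Psh C X) A A" if "A \<in> Ob (Psh C X)" for A
    using that by (auto simp: Hom_iff presheaf_map_def is_presheaf_def)
  show "Comp (Psh C X) g f \<in> Hom (Psh C X) A D"
    if "f \<in> Hom (Psh C X) A B" "g \<in> Hom (Psh C X) B D" for f g A B D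
    using that by (cases f, cases g) (auto simp: Hom_iff presheaf_map_compose)
  show "Comp (Psh C X) (Comp (Psh C X) h g) f = Comp (Psh C X) h (Comp (Psh C X) g f)"
    if "f \<in> Hom (Psh C X) A B" "g \<in> Hom (Psh C X) B D" "h \<in> Hom (Psh C X) D E" for f g h A B D E
    using that by (cases f, cases g, cases h)
      (auto simp: Hom_iff compose_def fun_eq_iff dest: presheaf_mapD(2))
qed (auto simp: Hom_iff Psh_def Let_def presheaf_map_def compose_def PiE_def extensional_def fun_eq_iff)

lemma presheaf_map_invertible:
  assumes A: "A \<in> Ob (Psh C X)" and B: "B \<in> Ob (Psh C X)"
    and h: "presheaf_map C X A B h" and bij: "bij_betw h (elts A) (elts B)"
  shows "invertible (Psh C X) (A, h, B)"
proof -
  \<comment> \<open>Arrows of \<open>Psh\<close> carry extensional functions, hence the cut to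
    \<open>elts B\<close>.\<close>
  define k where "k = (\<lambda>b \<in> elts B. inv_into (elts A) h b)"
  have k_in: "k b \<in> elts A" and hk: "h (k b) = b" if "b \<in> elts B" for b
    using that bij by (auto simp: k_def bij_betw_def inv_into_into f_inv_into_f)
  have kh: "k (h a) = a" if "a \<in> elts A" for a
    using that bij presheaf_mapD(2)[OF h that] by (auto simp: k_def bij_betw_def)
  have A': "is_presheaf C X A" using A by simp
  have "k (action B b e) = action A (k b) e" if "b \<in> elts B" "e \<in> rest_idem C X" for b e
    using kh[of "action A (k b) e"] presheaf_mapD(3)[OF h, of "k b" e] is_presheafD(1)[OF A', of "k b" e]
      k_in[OF that(1)] hk[OF that(1)] that
    by auto
  moreover have "extent A (k b) = extent B b" if "b \<in> elts B" for b
    using presheaf_mapD(4)[OF h k_in[OF that]] hk[OF that] by simp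
  ultimately have k: "presheaf_map C X B A k"
    using k_in by (auto simp: presheaf_map_def k_def)
  have "compose (elts A) k h = (\<lambda>a \<in> elts A. a)" "compose (elts B) h k = (\<lambda>b \<in> elts B. b)"
    using hk kh by (auto simp: compose_def fun_eq_iff)
  then show ?thesis
    using A B h k by (auto simp: invertible_def Hom_iff intro!: bexI[of _ "(B, k, A)"])
qed

lemma small_subset: "S \<subseteq> T \<Longrightarrow> small T \<Longrightarrow> small S"
  unfolding small_def by (metis lesspoll_trans1 subset_imp_lepoll)

section \<open>The functor of partial sections\<close>

locale glueing_base = join_restriction_category C
  for C :: "('o, 'm, 'z) rcat_scheme" (structure) +
  fixes X
  assumes X [simp]: "X \<in> Ob C"
    and locally_small: "locally_small C"
    and glueings: "has_local_glueings C"
begin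

lemmas O_rle_iff = rle_rest_idem_iff[where A = X]
lemmas O_commute = rest_idem_commute[where A = X]
lemmas O_left_commute = rest_idem_left_commute[where A = X]
lemmas O_arrow = rest_idem_arrow[where A = X]
lemmas O_arrow' [simp] = rest_idem_arrow(1-4)[where A = X]

lemma O_left_idem: "e \<in> rest_idem C X \<Longrightarrow> d \<in> rest_idem C X \<Longrightarrow> e \<cdot> (e \<cdot> d) = e \<cdot> d"
  by simp

lemma O_assoc:
  "e \<in> rest_idem C X \<Longrightarrow> d \<in> rest_idem C X \<Longrightarrow> c \<in> rest_idem C X \<Longrightarrow> (e \<cdot> d) \<cdot> c = e \<cdot> (d \<cdot> c)"
  by (simp add: comp_assoc)

text \<open>A normal form for composites in the semilattice of restriction idempotents on
  \<open>X\<close>.\<close>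

lemmas O_simps = O_assoc O_commute O_left_commute O_left_idem O_arrow(5)

lemma category_slice: "category (slice_t C X)"
proof
  fix f g h p q r t
  assume f: "f \<in> Hom (slice_t C X) p q" and g: "g \<in> Hom (slice_t C X) q r"
  obtain f' g' where fg: "f = (p, f', q)" "g = (q, g', r)"
    using f g by (cases f, cases g) (auto simp: Hom_iff)
  have a: "f' \<in> Ar C" "g' \<in> Ar C" "r \<in> Ar C" "Dom C f' = Dom C p" "Cod C f' = Dom C q"
    "Dom C g' = Dom C q" "Cod C g' = Dom C r" "r \<cdot> g' = q" "q \<cdot> f' = p"
    using f g by (auto simp: Hom_iff fg total_map_def)
  have "r \<cdot> (g' \<cdot> f') = p"
    using a comp_assoc[of f' g' r] by simp
  then show "Comp (slice_t C X) g f \<in> Hom (slice_t C X) p r"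
    using f g a by (simp add: Hom_iff fg)
  show "Comp (slice_t C X) (Comp (slice_t C X) h g) f
      = Comp (slice_t C X) h (Comp (slice_t C X) g f)"
    if "h \<in> Hom (slice_t C X) r t"
    using that a by (cases h) (auto simp: Hom_iff fg comp_assoc)
next
  fix f p q
  assume "f \<in> Hom (slice_t C X) p q"
  then obtain f' where f: "f = (p, f', q)" "(p, f', q) \<in> Ar (slice_t C X)"
    by (cases f) (simp add: Hom_iff)
  show "Comp (slice_t C X) f (Ident (slice_t C X) p) = f"
    "Comp (slice_t C X) (Ident (slice_t C X) q) f = f"
    using f by simp_all
next
  fix f
  assume "f \<in> Ar (slice_t C X)"
  then show "Dom (slice_t C X) f \<in> Ob (slice_t C X)" "Cod (slice_t C X) f \<in> Ob (slice_t C X)"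
    by (cases f, simp)+
qed (simp add: Hom_iff total_map_def)

lemma presheaf_Gamma:
  assumes "total_map C p" "Cod C p = X"
  shows "is_presheaf C X (Gamma_ob C p)"
  using assms
  by (auto simp: is_presheaf_def partial_section_iff total_map_def comp_assoc simp flip: comp_assoc[of _ _ p])

text \<open>Local smallness lets \<Gamma> land in \<open>Psh C X\<close>, whose objects have small
  carriers: the partial sections lie in a single hom set.\<close>

lemma small_Gamma:
  assumes "total_map C p" "Cod C p = X"
  shows "small (elts (Gamma_ob C p))"
proof (rule small_subset)
  show "elts (Gamma_ob C p) \<subseteq> Hom C X (Dom C p)"
    using assms by (auto simp: partial_section_iff Hom_iff)
  show "small (Hom C X (Dom C p))"
    using locally_small assms by (auto simp: locally_small_def total_map_def)
qed

lemma presheaf_map_Gamma: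
  assumes "(p, f, q) \<in> Ar (slice_t C X)"
  shows "presheaf_map C X (Gamma_ob C p) (Gamma_ob C q)
    (\<lambda>s \<in> {s. partial_section C p s}. f \<cdot> s)"
proof -
  have a: "p \<in> Ar C" "q \<in> Ar C" "f \<in> Ar C" "Dom C f = Dom C p" "Cod C f = Dom C q" "q \<cdot> f = p"
    "total_map C p" "total_map C q" "Cod C p = X" "Cod C q = X"
    using assms by (auto simp: total_map_def)
  \<comment> \<open>Totality of \<open>q\<close> is what preserves extents:
    \<open>f \<cdot> s\<close> has the same domain as
    \<open>q \<cdot> (f \<cdot> s)\<close>.\<close>
  have q: "q \<cdot> (f \<cdot> s) = Rst C s" and r: "Rst C (f \<cdot> s) = Rst C s" if "partial_section C p s" for s
  proof -
    show "q \<cdot> (f \<cdot> s) = Rst C s"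
      using that a by (simp add: partial_section_iff comp_assoc[symmetric])
    then show "Rst C (f \<cdot> s) = Rst C s"
      using that a rst_total_comp[of q "f \<cdot> s"] by (simp add: partial_section_iff)
  qed
  have e: "partial_section C p (s \<cdot> e)" if "partial_section C p s" "e \<in> rest_idem C X" for s e
    using is_presheafD(1)[OF presheaf_Gamma[OF a(7,9)], of s e] that by simp
  show ?thesis
    using a q r e by (auto simp: presheaf_map_def partial_section_iff comp_assoc)
qed

lemma functor_Gamma: "is_functor (slice_t C X) (Psh C X) (Gamma C)"
proof -
  have "far (Gamma C) f \<in> Hom (Psh C X) (Gamma_ob C (Dom (slice_t C X) f)) (Gamma_ob C (Cod (slice_t C X) f))"
    if "f \<in> Ar (slice_t C X)" for f
    using that by (cases f) (simp add: Hom_iff presheaf_map_Gamma presheaf_Gamma small_Gamma[simplified])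
  moreover have "far (Gamma C) (Ident (slice_t C X) p) = Ident (Psh C X) (Gamma_ob C p)"
    if "p \<in> Ob (slice_t C X)" for p
    using that by (auto simp: fun_eq_iff partial_section_iff)
  moreover have "far (Gamma C) (Comp (slice_t C X) g f)
      = Comp (Psh C X) (far (Gamma C) g) (far (Gamma C) f)"
    if fg: "f \<in> Ar (slice_t C X)" "g \<in> Ar (slice_t C X)"
      "Cod (slice_t C X) f = Dom (slice_t C X) g" for f g
  proof -
    obtain p f' q g' r where [simp]: "f = (p, f', q)" "g = (q, g', r)"
      using fg(3) by (cases f, cases g) auto
    show ?thesis
      using presheaf_mapD(2)[OF presheaf_map_Gamma[of p f' q]] fg(1,2)
      by (auto simp: fun_eq_iff compose_def partial_section_iff comp_assoc)
  qed
  ultimately show ?thesis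
    using category_slice category_Psh[of C X]
    by (auto simp: is_functor_def presheaf_Gamma small_Gamma[simplified])
qed

section \<open>The truth values of equality in a presheaf form a local atlas\<close>

context
  fixes A :: "('a, 'm) presheaf"
  assumes A: "is_presheaf C X A"
begin

lemma extent_rest_idem [simp]: "a \<in> elts A \<Longrightarrow> extent A a \<in> rest_idem C X"
  by (rule is_presheafD(4)[OF A])

text \<open>\<open>psh_eq\<close> is a join among idempotents, whereas the join axioms speak of hom
  sets. The join of the witnesses in \<open>Hom C X X\<close> lies below the identity, so it is
  itself an idempotent and serves as the join in both.\<close>

lemma psh_eq_join:
  assumes a: "a \<in> elts A" and b: "b \<in> elts A"
  shows "psh_eq C X A a b \<in> rest_idem C X"
    "is_join (rle C) (Hom C X X)
      {e \<in> rest_idem C X. rle C e (extent A a \<cdot> extent A b) \<and> action A a e = action A b e}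
      (psh_eq C X A a b)"
proof -
  let ?E = "{e \<in> rest_idem C X. rle C e (extent A a \<cdot> extent A b) \<and> action A a e = action A b e}"
  have "rle C e (Ident C X)" if "e \<in> ?E" for e
    using that by (simp add: O_rle_iff)
  then obtain d where d: "is_join (rle C) (Hom C X X) ?E d" and "rle C d (Ident C X)"
    using bounded_join[of ?E "Ident C X" X X] by (force simp: Hom_iff)
  then have dO: "d \<in> rest_idem C X"
    using rleD[of d "Ident C X"] by (auto simp: rest_idem_iff simp del: O_arrow')
  have dj: "is_join (rle C) (rest_idem C X) ?E d"
    using d dO by (auto simp: is_join_def Hom_iff)
  have "psh_eq C X A a b = d"
    unfolding psh_eq_def
  proof (rule the_equality[where a = d], rule dj)
    fix d' assume "is_join (rle C) (rest_idem C X) ?E d'"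
    with dj show "d' = d"
      by (intro rle_antisym) (auto simp: is_join_def)
  qed
  with d dO show "psh_eq C X A a b \<in> rest_idem C X"
    "is_join (rle C) (Hom C X X) ?E (psh_eq C X A a b)"
    by auto
qed

lemma psh_eq_le:
  assumes a: "a \<in> elts A" and b: "b \<in> elts A"
  shows "psh_eq C X A a b \<cdot> (extent A a \<cdot> extent A b) = psh_eq C X A a b"
  using is_joinD(5)[OF psh_eq_join(2)[OF a b], of "extent A a \<cdot> extent A b"] psh_eq_join(1)[OF a b] a b
    rle_rest_idem_iff[of "psh_eq C X A a b" X "extent A a \<cdot> extent A b"]
  by (auto simp: Hom_iff)

lemma le_psh_eq:
  assumes a: "a \<in> elts A" and b: "b \<in> elts A" and e: "e \<in> rest_idem C X"
    and "e \<cdot> (extent A a \<cdot> extent A b) = e" "action A a e = action A b e"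
  shows "e \<cdot> psh_eq C X A a b = e"
proof -
  have "rle C e (psh_eq C X A a b)"
    using is_joinD(4)[OF psh_eq_join(2)[OF a b], of e] assms by (auto simp: O_rle_iff)
  then show ?thesis
    using rle_rest_idem_iff[OF e psh_eq_join(1)[OF a b]] by simp
qed

lemma psh_eq_sym: "psh_eq C X A a b = psh_eq C X A b a" if "a \<in> elts A" "b \<in> elts A"
  unfolding psh_eq_def using O_commute[of "extent A a" "extent A b"] that
  by (simp add: eq_commute)

text \<open>As \<open>a\<close> and \<open>b\<close> may disagree on
  \<open>psh_eq C X A a b\<close>, the argument runs over witnesses: if \<open>e\<close> witnesses
  \<open>a = b\<close> and \<open>f\<close> witnesses \<open>b = c\<close>, their composite
  witnesses \<open>a = c\<close>. Stability of joins under precomposition then extends this to the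
  joins.\<close>

lemma psh_eq_trans:
  assumes a: "a \<in> elts A" and b: "b \<in> elts A" and c: "c \<in> elts A"
  shows "(psh_eq C X A b c \<cdot> psh_eq C X A a b) \<cdot> psh_eq C X A a c
    = psh_eq C X A b c \<cdot> psh_eq C X A a b"
proof -
  let ?E = "\<lambda>a b. {e \<in> rest_idem C X. rle C e (extent A a \<cdot> extent A b) \<and> action A a e = action A b e}"
  note [simp] = psh_eq_join(1)[OF a b] psh_eq_join(1)[OF b c] psh_eq_join(1)[OF a c] assms
  have ef: "(e \<cdot> f) \<cdot> psh_eq C X A a c = e \<cdot> f" if "e \<in> ?E a b" "f \<in> ?E b c" for e f
  proof (rule le_psh_eq)
    have [simp]: "e \<in> rest_idem C X" "f \<in> rest_idem C X" using that by auto
    have e: "e \<cdot> (extent A a \<cdot> extent A b) = e" and f: "f \<cdot> (extent A b \<cdot> extent A c) = f"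
      using that by (auto simp: O_rle_iff)
    have "(e \<cdot> f) \<cdot> (extent A a \<cdot> extent A c)
        = (e \<cdot> (extent A a \<cdot> extent A b) \<cdot> (f \<cdot> (extent A b \<cdot> extent A c))) \<cdot> (extent A a \<cdot> extent A c)"
      by (simp only: e f)
    also have "\<dots> = (e \<cdot> (extent A a \<cdot> extent A b)) \<cdot> (f \<cdot> (extent A b \<cdot> extent A c))"
      by (simp add: O_simps)
    finally show "(e \<cdot> f) \<cdot> (extent A a \<cdot> extent A c) = e \<cdot> f"
      by (simp only: e f)
    have "action A a (e \<cdot> f) = action A (action A b e) f"
      using that by (simp flip: is_presheafD(3)[OF A])
    also have "\<dots> = action A (action A b f) e"
      by (simp add: is_presheafD(3)[OF A] O_commute)
    also have "\<dots> = action A c (e \<cdot> f)"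
      using that by (simp add: is_presheafD(3)[OF A] O_commute)
    finally show "action A a (e \<cdot> f) = action A c (e \<cdot> f)" .
  qed (use that in auto)
  \<comment> \<open>With \<open>f\<close> fixed, \<open>e\<close> is replaced by its join; after
    that \<open>f\<close> is treated in the same way.\<close>
  have "(psh_eq C X A a b \<cdot> f) \<cdot> psh_eq C X A a c = psh_eq C X A a b \<cdot> f" if f: "f \<in> ?E b c" for f
  proof -
    have [simp]: "f \<in> rest_idem C X" using f by auto
    have "Rst C (psh_eq C X A a b \<cdot> f) \<cdot> psh_eq C X A a c = Rst C (psh_eq C X A a b \<cdot> f)"
      by (rule join_rst_le[OF bounded_join_precomp[OF psh_eq_join(2)[OF a b]]])
        (use f ef in \<open>auto simp: Hom_iff\<close>)
    then show ?thesis by simp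
  qed
  then have "Rst C (psh_eq C X A b c \<cdot> psh_eq C X A a b) \<cdot> psh_eq C X A a c
      = Rst C (psh_eq C X A b c \<cdot> psh_eq C X A a b)"
    by (intro join_rst_le[OF bounded_join_precomp[OF psh_eq_join(2)[OF b c]]])
      (auto simp: Hom_iff O_commute[of _ "psh_eq C X A a b"])
  then show ?thesis by simp
qed

text \<open>\<open>extent A a \<cdot> e\<close> is itself a witness and also the upper bound imposed
  on all witnesses. This is what makes the unit respect the action; taking \<open>e\<close> to be
  the identity gives reflexivity.\<close>

lemma psh_eq_action:
  assumes a: "a \<in> elts A" and e: "e \<in> rest_idem C X"
  shows "psh_eq C X A a (action A a e) = extent A a \<cdot> e"
proof -
  note [simp] = assms is_presheafD(1,6)[OF A a e] psh_eq_join(1)[OF a is_presheafD(1)[OF A a e]]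
  have "action A a (extent A a \<cdot> e) = action A (action A a e) (extent A a \<cdot> e)"
    by (simp add: is_presheafD(3)[OF A] O_simps)
  then have "(extent A a \<cdot> e) \<cdot> psh_eq C X A a (action A a e) = extent A a \<cdot> e"
    by (intro le_psh_eq) (auto simp: O_simps)
  moreover have "psh_eq C X A a (action A a e) \<cdot> (extent A a \<cdot> e) = psh_eq C X A a (action A a e)"
    using psh_eq_le[OF a is_presheafD(1)[OF A a e]] by (simp add: O_simps)
  ultimately show ?thesis
    using O_commute[of "extent A a \<cdot> e" "psh_eq C X A a (action A a e)"] by simp
qed

lemma psh_eq_refl: "a \<in> elts A \<Longrightarrow> psh_eq C X A a a = extent A a"
  using psh_eq_action[of a "Ident C X"] is_presheafD(2)[OF A] by simp

lemma local_atlas_psh_eq: "local_atlas C X (elts A) (psh_eq C X A)"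
  unfolding local_atlas_def
proof (intro conjI ballI)
  fix a b c assume "a \<in> elts A" "b \<in> elts A" "c \<in> elts A"
  then show "rle C (psh_eq C X A b c \<cdot> psh_eq C X A a b) (psh_eq C X A a c)"
    by (simp add: psh_eq_trans psh_eq_join(1) O_rle_iff)
qed (auto intro: psh_eq_join(1) psh_eq_sym)

end

text \<open>The choice is legitimate: objects of \<open>Psh\<close> have small carriers, and these
  index the atlas of truth values.\<close>

lemma Delta_glueing:
  assumes "A \<in> Ob (Psh C X)"
  shows "is_glueing C X (elts A) (psh_eq C X A) (Delta_ob C X A) (Delta_section C X A)"
proof -
  have "\<exists>x. case x of (p, s) \<Rightarrow> is_glueing C X (elts A) (psh_eq C X A) p s"
    using glueings local_atlas_psh_eq[of A] assms X unfolding has_local_glueings_def by fastforce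
  from someI_ex[OF this] show ?thesis
    by (simp add: Delta_ob_def Delta_section_def Delta_glueing_def case_prod_unfold)
qed

text \<open>\<open>is_glueing\<close> quantifies the charts existentially, while the sections are
  fixed by the choice; so each use obtains charts afresh.\<close>

lemma Delta_cover:
  assumes "A \<in> Ob (Psh C X)"
  obtains P where "cover C (Delta_ob C X A) P (Delta_section C X A) (elts A)"
    "\<And>a b. a \<in> elts A \<Longrightarrow> b \<in> elts A \<Longrightarrow> P b \<cdot> Delta_section C X A a = psh_eq C X A a b"
proof -
  obtain P where P: "\<And>a. a \<in> elts A \<Longrightarrow> partial_inverse C (P a) (Delta_section C X A a)"
    "is_join (rle C) (Hom C (Dom C (Delta_ob C X A)) X) (P ` elts A) (Delta_ob C X A)"
    "\<And>a b. a \<in> elts A \<Longrightarrow> b \<in> elts A \<Longrightarrow> psh_eq C X A a b = P b \<cdot> Delta_section C X A a"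
    and "total_map C (Delta_ob C X A)" "Cod C (Delta_ob C X A) = X"
    using Delta_glueing[OF assms] unfolding is_glueing_def local_homeomorphism_def by blast
  then have "cover C (Delta_ob C X A) P (Delta_section C X A) (elts A)"
    by unfold_locales simp_all
  then show ?thesis by (rule that) (rule P(3)[symmetric])
qed

lemma Delta_ob:
  assumes "A \<in> Ob (Psh C X)"
  shows "local_homeomorphism C (Delta_ob C X A)" "total_map C (Delta_ob C X A)"
    "Cod C (Delta_ob C X A) = X"
  using Delta_glueing[OF assms] unfolding is_glueing_def local_homeomorphism_def by blast+

end

section \<open>Fixpoints of the adjunction\<close>

context glueing_base
begin

lemma partial_sectionD:
  assumes "total_map C p" "Cod C p = X" "partial_section C p x"
  shows "x \<in> Ar C" "Dom C x = X" "Cod C x = Dom C p" "p \<cdot> x = Rst C x" "Rst C x \<in> rest_idem C X"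
  using assms by (simp_all add: partial_section_iff)

text \<open>The covering set of partial isomorphisms serves as its own index set; only the partial
  inverses have to be chosen.\<close>

lemma cover_of_local_homeomorphism:
  assumes "local_homeomorphism C p"
  obtains s F where "cover C p (\<lambda>t. t) s F"
proof -
  obtain F where F: "\<And>t. t \<in> F \<Longrightarrow> partial_iso C t" and p: "total_map C p"
    and join: "is_join (rle C) (Hom C (Dom C p) (Cod C p)) F p"
    using assms unfolding local_homeomorphism_def by blast
  obtain s where "partial_inverse C t (s t)" if "t \<in> F" for t
    using F unfolding partial_iso_def by metis
  then have "cover C p (\<lambda>t. t) s F"
    using p join by unfold_locales simp_all
  then show ?thesis by (rule that)
qed

lemma Gamma_faithful:
  assumes p: "local_homeomorphism C p" and "k \<in> Hom C (Dom C p) D" "l \<in> Hom C (Dom C p) D"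
    and eq: "\<And>x. partial_section C p x \<Longrightarrow> k \<cdot> x = l \<cdot> x"
  shows "k = l"
proof -
  obtain s F where "cover C p (\<lambda>t. t) s F"
    using cover_of_local_homeomorphism[OF p] .
  then interpret cover C p "\<lambda>t. t" s F .
  show ?thesis
    by (rule maps_eqI[OF assms(2,3)]) (use eq sect_partial_section in blast)
qed

text \<open>Glue the values \<open>H (s t)\<close>. Since \<open>H\<close> commutes with the action,
  the agreement of \<open>x\<close> with \<open>s t\<close> on \<open>t \<cdot> x\<close> carries
  over to \<open>H x\<close> and \<open>H (s t)\<close>; this is \<open>transport\<close>. For
  \<open>x\<close> a covering section it is the overlap condition, and for general \<open>x\<close>
  it identifies the effect of the glued map with \<open>H\<close>.\<close>

lemma Gamma_full:
  assumes p: "local_homeomorphism C p" "Cod C p = X" and q: "total_map C q" "Cod C q = X"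
    and H: "presheaf_map C X (Gamma_ob C p) (Gamma_ob C q) H"
  shows "\<exists>k \<in> Hom C (Dom C p) (Dom C q). q \<cdot> k = p \<and> (\<forall>x. partial_section C p x \<longrightarrow> k \<cdot> x = H x)"
proof -
  obtain s F where "cover C p (\<lambda>t. t) s F"
    using cover_of_local_homeomorphism[OF p(1)] .
  then interpret cover C p "\<lambda>t. t" s F .
  have H_section: "partial_section C q (H x)" and H_rst: "Rst C (H x) = Rst C x"
    if "partial_section C p x" for x
    using presheaf_mapD(2,4)[OF H, of x] that by simp_all
  have H_action: "H (x \<cdot> e) = H x \<cdot> e" if "partial_section C p x" "e \<in> rest_idem C X" for x e
    using presheaf_mapD(3)[OF H, of x e] that by simp
  have transport: "H x \<cdot> (t \<cdot> x) = H (s t) \<cdot> (t \<cdot> x)" if "t \<in> F" "partial_section C p x" for t x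
    using H_action[OF that(2), of "t \<cdot> x"] H_action[OF sect_partial_section[OF that(1)], of "t \<cdot> x"]
      chart_partial_section(1,3)[OF that] p(2) by simp
  have "\<exists>k \<in> Hom C (Dom C p) (Dom C q). q \<cdot> k = p \<and> (\<forall>t \<in> F. k \<cdot> s t = H (s t))"
  proof (rule glue_maps)
    show "H (s t) \<cdot> (u \<cdot> s t) = H (s u) \<cdot> (u \<cdot> s t)" if "t \<in> F" "u \<in> F" for t u
      using transport[OF that(2) sect_partial_section[OF that(1)]] .
  qed (use p q H_section H_rst sect_partial_section in auto)
  then obtain k where kH: "k \<in> Hom C (Dom C p) (Dom C q)" "q \<cdot> k = p"
    and ks: "\<And>t. t \<in> F \<Longrightarrow> k \<cdot> s t = H (s t)"
    by blast
  have k: "k \<in> Ar C" "Dom C k = Dom C p" "Cod C k = Dom C q" "q \<cdot> k = p"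
    using kH by (simp_all add: Hom_iff)
  have "k \<cdot> x = H x" if x: "partial_section C p x" for x
  proof -
    note x' [simp] = partial_sectionD[OF total p(2) x]
    note Hx [simp] = partial_sectionD(1-3)[OF q H_section[OF x]]
    have "(k \<cdot> x) \<cdot> Rst C x = H x \<cdot> Rst C x"
    proof (rule eq_on_partial_section[OF x])
      fix t assume t: "t \<in> F"
      have "(k \<cdot> x) \<cdot> (t \<cdot> x) = k \<cdot> (x \<cdot> (t \<cdot> x))"
        using t k p(2) chart[OF t] by (intro comp_assoc) simp_all
      also have "\<dots> = (k \<cdot> s t) \<cdot> (t \<cdot> x)"
        unfolding chart_partial_section(3)[OF t x]
        using t k p(2) chart[OF t] by (intro comp_assoc[symmetric]) simp_all
      also have "\<dots> = H x \<cdot> (t \<cdot> x)"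
        unfolding ks[OF t] transport[OF t x] ..
      finally show "(k \<cdot> x) \<cdot> (t \<cdot> x) = H x \<cdot> (t \<cdot> x)" .
    qed (use k p(2) in \<open>simp_all add: Hom_iff\<close>)
    moreover have "(k \<cdot> x) \<cdot> Rst C x = k \<cdot> x"
      using k by (simp add: comp_assoc)
    moreover have "H x \<cdot> Rst C x = H x"
      using comp_rst[OF Hx(1)] unfolding H_rst[OF x] .
    ultimately show ?thesis by simp
  qed
  with k show ?thesis
    by (intro bexI[of _ k]) (simp_all add: Hom_iff)
qed

section \<open>The glueing of a presheaf as a universal arrow\<close>

context
  fixes A :: "('m, 'm) presheaf"
  assumes A: "A \<in> Ob (Psh C X)"
begin

lemma presheaf_A: "is_presheaf C X A"
  using A by simp

text \<open>The extent comes out as the chart of \<open>a\<close> composed with its own section,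
  which is the truth value of \<open>a = a\<close>.\<close>

lemma Delta_section_partial_section:
  assumes a: "a \<in> elts A"
  shows "partial_section C (Delta_ob C X A) (Delta_section C X A a)"
    "Rst C (Delta_section C X A a) = extent A a"
proof -
  obtain P where P: "cover C (Delta_ob C X A) P (Delta_section C X A) (elts A)"
    "\<And>a b. a \<in> elts A \<Longrightarrow> b \<in> elts A \<Longrightarrow> P b \<cdot> Delta_section C X A a = psh_eq C X A a b"
    by (rule Delta_cover[OF A]) (rule that)
  show "partial_section C (Delta_ob C X A) (Delta_section C X A a)"
    using cover.sect_partial_section[OF P(1) a] .
  show "Rst C (Delta_section C X A a) = extent A a"
    unfolding cover.sect(5)[OF P(1) a, symmetric] P(2)[OF a a] by (rule psh_eq_refl[OF presheaf_A a])
qed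

lemmas Delta_section_arrow =
  partial_sectionD(1-4)[OF Delta_ob(2,3)[OF A] Delta_section_partial_section(1)]

text \<open>The truth value is the part of the domain on which the section of \<open>a\<close> lies
  in the chart of \<open>b\<close>. So agreement on it holds among sections even where it fails in
  \<open>A\<close>.\<close>

lemma Delta_section_psh_eq:
  assumes a: "a \<in> elts A" and b: "b \<in> elts A"
  shows "Delta_section C X A a \<cdot> psh_eq C X A a b = Delta_section C X A b \<cdot> psh_eq C X A a b"
proof -
  obtain P where P: "cover C (Delta_ob C X A) P (Delta_section C X A) (elts A)"
    "\<And>a b. a \<in> elts A \<Longrightarrow> b \<in> elts A \<Longrightarrow> P b \<cdot> Delta_section C X A a = psh_eq C X A a b"
    by (rule Delta_cover[OF A]) (rule that)
  show ?thesis
    using cover.chart_partial_section(3)[OF P(1) b Delta_section_partial_section(1)[OF a]]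
    unfolding P(2)[OF a b] .
qed

text \<open>The section of \<open>action A a e\<close> has extent
  \<open>extent A a \<cdot> e\<close>. By \<open>psh_eq_action\<close> this is the truth value of
  its equality with \<open>a\<close>, so it coincides with the section of \<open>a\<close> on all of
  its domain.\<close>

lemma Delta_section_action:
  assumes a: "a \<in> elts A" and e: "e \<in> rest_idem C X"
  shows "Delta_section C X A (action A a e) = Delta_section C X A a \<cdot> e"
proof -
  let ?s = "Delta_section C X A"
  note b = is_presheafD(1)[OF presheaf_A a e]
  note [simp] = Delta_section_arrow(1-3)[OF a] Delta_section_arrow(1-3)[OF b] e
  have r: "Rst C (?s (action A a e)) = extent A a \<cdot> e"
    using Delta_section_partial_section(2)[OF b] is_presheafD(6)[OF presheaf_A a e] by simp
  have "?s (action A a e) = ?s (action A a e) \<cdot> (extent A a \<cdot> e)"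
    using comp_rst[of "?s (action A a e)"] unfolding r by simp
  also have "\<dots> = ?s a \<cdot> (extent A a \<cdot> e)"
    using Delta_section_psh_eq[OF a b] unfolding psh_eq_action[OF presheaf_A a e] by simp
  also have "\<dots> = (?s a \<cdot> Rst C (?s a)) \<cdot> e"
    unfolding Delta_section_partial_section(2)[OF a, symmetric]
    by (intro comp_assoc[symmetric]) simp_all
  finally show ?thesis by simp
qed

lemma presheaf_map_Delta_section:
  "presheaf_map C X A (Gamma_ob C (Delta_ob C X A)) (\<lambda>a \<in> elts A. Delta_section C X A a)"
  using Delta_section_partial_section Delta_section_action is_presheafD(1)[OF presheaf_A]
  by (simp add: presheaf_map_def)

text \<open>The overlap condition of \<open>glue_maps\<close> asks that \<open>h a\<close> and
  \<open>h b\<close> agree on the truth value of \<open>a = b\<close>. They agree on every witness,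
  as \<open>h\<close> respects the action, and arrows of \<open>C\<close> that agree on each of a
  family of idempotents agree on the join.\<close>

lemma Delta_universal:
  assumes q: "total_map C q" "Cod C q = X" and h: "presheaf_map C X A (Gamma_ob C q) h"
  shows "\<exists>k \<in> Hom C (Dom C (Delta_ob C X A)) (Dom C q).
    q \<cdot> k = Delta_ob C X A \<and> (\<forall>a \<in> elts A. k \<cdot> Delta_section C X A a = h a)"
proof -
  obtain P where P: "cover C (Delta_ob C X A) P (Delta_section C X A) (elts A)"
    "\<And>a b. a \<in> elts A \<Longrightarrow> b \<in> elts A \<Longrightarrow> P b \<cdot> Delta_section C X A a = psh_eq C X A a b"
    by (rule Delta_cover[OF A]) (rule that)
  have h_section: "partial_section C q (h a)" and h_rst: "Rst C (h a) = extent A a"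
    if "a \<in> elts A" for a
    using presheaf_mapD(2,4)[OF h that] by simp_all
  show ?thesis
  proof (rule cover.glue_maps[OF P(1) q(1)])
    fix a b assume a: "a \<in> elts A" and b: "b \<in> elts A"
    have "h a \<cdot> Rst C (psh_eq C X A a b) = h b \<cdot> Rst C (psh_eq C X A a b)"
    proof (rule eq_on_join[OF psh_eq_join(2)[OF presheaf_A a b]])
      show "h a \<in> Hom C X (Dom C q)" "h b \<in> Hom C X (Dom C q)"
        using partial_sectionD[OF q h_section[OF a]] partial_sectionD[OF q h_section[OF b]]
        by (simp_all add: Hom_iff)
      fix e assume e: "e \<in> {e \<in> rest_idem C X. rle C e (extent A a \<cdot> extent A b) \<and> action A a e = action A b e}"
      then show "h a \<cdot> Rst C e = h b \<cdot> Rst C e"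
        using presheaf_mapD(3)[OF h a, of e] presheaf_mapD(3)[OF h b, of e] by simp
    qed
    then show "h a \<cdot> (P b \<cdot> Delta_section C X A a) = h b \<cdot> (P b \<cdot> Delta_section C X A a)"
      using a b by (simp add: P(2) psh_eq_join(1)[OF presheaf_A])
  qed (use q h_section h_rst Delta_ob[OF A] Delta_section_partial_section(2) in simp_all)
qed

lemma Delta_universal_unique:
  assumes "k \<in> Hom C (Dom C (Delta_ob C X A)) D" "l \<in> Hom C (Dom C (Delta_ob C X A)) D"
    and "\<And>a. a \<in> elts A \<Longrightarrow> k \<cdot> Delta_section C X A a = l \<cdot> Delta_section C X A a"
  shows "k = l"
proof -
  obtain P where "cover C (Delta_ob C X A) P (Delta_section C X A) (elts A)"
    by (rule Delta_cover[OF A]) (rule that)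
  from cover.maps_eqI[OF this assms] show ?thesis .
qed

end

lemma adjunction_Delta_Gamma:
  "adjunction (Psh C X) (slice_t C X) (Delta C X) (Gamma C) (Delta_unit C X) (Delta_counit C X)"
  unfolding Delta_def Delta_counit_def
proof (rule adjunction_of_universal_arrows[OF functor_Gamma])
  fix A assume A: "A \<in> Ob (Psh C X)"
  let ?d = "Delta_ob C X A" and ?s = "Delta_section C X A"
  note d = Delta_ob(2,3)[OF A]
  show "?d \<in> Ob (slice_t C X)"
    using d by simp
  show "Delta_unit C X A \<in> Hom (Psh C X) A (fob (Gamma C) ?d)"
    using A d presheaf_map_Delta_section[OF A] presheaf_Gamma[OF d] small_Gamma[OF d]
    by (simp add: Delta_unit_def Hom_iff)
  fix q h assume q': "q \<in> Ob (slice_t C X)" and h': "h \<in> Hom (Psh C X) A (fob (Gamma C) q)"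
  have q: "total_map C q" "Cod C q = X" using q' by simp_all
  obtain h0 where h: "h = (A, h0, Gamma_ob C q)" and h0: "presheaf_map C X A (Gamma_ob C q) h0"
    using h' by (cases h) (simp add: Hom_iff)
  have arrow: "k \<in> Hom (slice_t C X) ?d q \<longleftrightarrow>
      (\<exists>k0 \<in> Hom C (Dom C ?d) (Dom C q). k = (?d, k0, q) \<and> q \<cdot> k0 = ?d)" for k
    using d q by (cases k) (auto simp: Hom_iff)
  \<comment> \<open>Off \<open>elts A\<close> both functions are undefined, \<open>h0\<close> being
    extensional, so equality is decided on \<open>elts A\<close>.\<close>
  have comp: "Comp (Psh C X) (far (Gamma C) (?d, k0, q)) (Delta_unit C X A) = h \<longleftrightarrow>
      (\<forall>a \<in> elts A. k0 \<cdot> ?s a = h0 a)" for k0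
    using presheaf_mapD(1)[OF h0] Delta_section_partial_section(1)[OF A]
    by (auto simp: Delta_unit_def h compose_def fun_eq_iff extensional_def)
  show "\<exists>!k. k \<in> Hom (slice_t C X) ?d q \<and> Comp (Psh C X) (far (Gamma C) k) (Delta_unit C X A) = h"
  proof (rule ex_ex1I)
    show "\<exists>k. k \<in> Hom (slice_t C X) ?d q \<and> Comp (Psh C X) (far (Gamma C) k) (Delta_unit C X A) = h"
      using Delta_universal[OF A q h0] arrow comp by blast
    fix k l
    assume k: "k \<in> Hom (slice_t C X) ?d q \<and> Comp (Psh C X) (far (Gamma C) k) (Delta_unit C X A) = h"
      and l: "l \<in> Hom (slice_t C X) ?d q \<and> Comp (Psh C X) (far (Gamma C) l) (Delta_unit C X A) = h"
    obtain k0 where k0: "k0 \<in> Hom C (Dom C ?d) (Dom C q)" "k = (?d, k0, q)"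
      using k arrow by blast
    obtain l0 where l0: "l0 \<in> Hom C (Dom C ?d) (Dom C q)" "l = (?d, l0, q)"
      using l arrow by blast
    have "k0 = l0"
      by (rule Delta_universal_unique[OF A k0(1) l0(1)]) (use k l k0(2) l0(2) comp in metis)
    then show "k = l" using k0 l0 by simp
  qed
qed

lemma adjoint_pair_Delta_Gamma:
  "adjoint_pair (Psh C X) (slice_t C X) (Delta C X) (Gamma C) (Delta_unit C X) (Delta_counit C X)"
  by unfold_locales (rule adjunction_Delta_Gamma)

lemma fob_Delta [simp]: "fob (Delta C X) A = Delta_ob C X A"
  by (simp add: Delta_def left_adjoint_of_unit_def)

lemma counit_invertible_local_homeomorphism:
  assumes p: "local_homeomorphism C p" "Cod C p = X"
  shows "invertible (slice_t C X) (Delta_counit C X p)"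
proof (rule adjoint_pair.counit_invertible[OF adjoint_pair_Delta_Gamma])
  have t: "total_map C p" using p by (simp add: local_homeomorphism_def)
  let ?G = "Gamma_ob C p"
  have G: "?G \<in> Ob (Psh C X)"
    using presheaf_Gamma[OF t p(2)] small_Gamma[OF t p(2)] by simp
  note d = Delta_ob(2,3)[OF G]
  show "p \<in> Ob (slice_t C X)" using t p by simp
  obtain m where m: "m \<in> Hom C (Dom C p) (Dom C (Delta_ob C X ?G))" "Delta_ob C X ?G \<cdot> m = p"
    "\<And>x. partial_section C p x \<Longrightarrow> m \<cdot> x = Delta_section C X ?G x"
    using Gamma_full[OF p d presheaf_map_Delta_section[OF G]] by auto
  show "\<exists>m \<in> Hom (slice_t C X) p (fob (Delta C X) (fob (Gamma C) p)).
      far (Gamma C) m = Delta_unit C X (fob (Gamma C) p)"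
    using m t d p(2)
    by (intro bexI[of _ "(p, m, Delta_ob C X ?G)"])
      (simp_all add: Hom_iff Delta_unit_def fun_eq_iff)
  fix k
  assume k: "k \<in> Hom (slice_t C X) p p" "far (Gamma C) k = Ident (Psh C X) (fob (Gamma C) p)"
  obtain k0 where k0: "k = (p, k0, p)" "k0 \<in> Hom C (Dom C p) (Dom C p)"
    using k(1) by (cases k) (simp add: Hom_iff)
  have "k0 = Ident C (Dom C p)"
  proof (rule Gamma_faithful[OF p(1) k0(2)])
    show "Ident C (Dom C p) \<in> Hom C (Dom C p) (Dom C p)"
      using t by (simp add: Hom_iff total_map_def)
    fix x assume x: "partial_section C p x"
    have "(\<lambda>s \<in> {s. partial_section C p s}. k0 \<cdot> s) = (\<lambda>s \<in> {s. partial_section C p s}. s)"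
      using k(2) by (simp add: k0)
    from fun_cong[OF this, of x] show "k0 \<cdot> x = Ident C (Dom C p) \<cdot> x"
      using x partial_sectionD[OF t p(2) x] by simp
  qed
  then show "k = Ident (slice_t C X) p" by (simp add: k0)
qed

section \<open>The sheaf condition and invertibility of the unit\<close>

lemma sheaf_Gamma:
  assumes p: "total_map C p" "Cod C p = X"
  shows "is_sheaf C X (Gamma_ob C p)"
  unfolding is_sheaf_def
proof (intro conjI allI impI)
  show "is_presheaf C X (Gamma_ob C p)" by (rule presheaf_Gamma[OF p])
  fix F assume F: "F \<subseteq> elts (Gamma_ob C p)"
    and compat: "\<forall>a\<in>F. \<forall>b\<in>F. psh_compatible (Gamma_ob C p) a b"
  have F_section: "partial_section C p x" if "x \<in> F" for x
    using F that by auto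
  have le: "psh_le (Gamma_ob C p) x y \<longleftrightarrow> rle C x y"
    if "partial_section C p x" "partial_section C p y" for x y
    using partial_sectionD[OF p that(1)] partial_sectionD[OF p that(2)]
    by (simp add: psh_le_def rle_def parallel_def)
  have pA: "p \<in> Ar C" using p by (simp add: total_map_def)
  have "compatible C x y" if "x \<in> F" "y \<in> F" for x y
    using compat that partial_sectionD[OF p F_section[OF that(1)]] partial_sectionD[OF p F_section[OF that(2)]]
    by (simp add: compatible_def parallel_def psh_compatible_def)
  moreover have "F \<subseteq> Hom C X (Dom C p)"
    using partial_sectionD(1-3)[OF p F_section] by (auto simp: Hom_iff)
  ultimately obtain h where h: "is_join (rle C) (Hom C X (Dom C p)) F h"
    using join_exists[of X "Dom C p" F] Dom_Ob[OF pA] by auto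
  note [simp] = is_joinD(1-3)[OF h] pA p(2)
  \<comment> \<open>A join of partial sections is again one: \<open>p \<cdot> h\<close> acts as the
    identity on the domain of each member, hence on the domain of \<open>h\<close>.\<close>
  have "(p \<cdot> h) \<cdot> Rst C h = Ident C X \<cdot> Rst C h"
  proof (rule eq_on_join[OF h])
    fix x assume x: "x \<in> F"
    note [simp] = partial_sectionD[OF p F_section[OF x]]
    show "(p \<cdot> h) \<cdot> Rst C x = Ident C X \<cdot> Rst C x"
      using rleD(5)[OF is_joinD(4)[OF h x]] by (simp add: comp_assoc)
  qed (simp_all add: Hom_iff)
  then have hs: "partial_section C p h"
    by (simp add: comp_assoc partial_section_iff)
  have "is_join (psh_le (Gamma_ob C p)) (elts (Gamma_ob C p)) F h"
    unfolding is_join_def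
  proof (intro conjI ballI impI)
    fix x assume "x \<in> F"
    then show "psh_le (Gamma_ob C p) x h"
      using is_joinD(4)[OF h] le[OF F_section hs] by simp
  next
    fix y assume "y \<in> elts (Gamma_ob C p)" and y: "\<forall>x\<in>F. psh_le (Gamma_ob C p) x y"
    then have ys: "partial_section C p y" by simp
    have "rle C h y"
      by (rule is_joinD(5)[OF h])
        (use partial_sectionD[OF p ys] y le[OF F_section ys] in \<open>simp_all add: Hom_iff\<close>)
    then show "psh_le (Gamma_ob C p) h y"
      using le[OF hs ys] by simp
  qed (use hs in simp)
  then show "\<exists>c. is_join (psh_le (Gamma_ob C p)) (elts (Gamma_ob C p)) F c" ..
qed

text \<open>Sheaves are separated: the elements \<open>action A a e\<close>, for \<open>e\<close> a
  witness, are compatible and have a join \<open>c\<close>. The restrictions of \<open>a\<close> and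
  of \<open>b\<close> to the truth value are both upper bounds, and the extent of \<open>c\<close>
  contains the truth value, so each of them equals \<open>c\<close>.\<close>

lemma sheaf_action_psh_eq:
  assumes A: "is_sheaf C X A" and a: "a \<in> elts A" and b: "b \<in> elts A"
  shows "action A a (psh_eq C X A a b) = action A b (psh_eq C X A a b)"
proof -
  let ?E = "{e \<in> rest_idem C X. rle C e (extent A a \<cdot> extent A b) \<and> action A a e = action A b e}"
  let ?d = "psh_eq C X A a b"
  have A': "is_presheaf C X A" using A by (simp add: is_sheaf_def)
  note d = psh_eq_join(1)[OF A' a b]
  note ea = is_presheafD(4)[OF A' a] and eb = is_presheafD(4)[OF A' b]
  have e: "e \<in> rest_idem C X" "action A a e = action A b e" "e \<cdot> ?d = e"
    "extent A a \<cdot> e = e" if "e \<in> ?E" for e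
  proof -
    show e: "e \<in> rest_idem C X" and eq: "action A a e = action A b e" using that by simp_all
    have le: "e \<cdot> (extent A a \<cdot> extent A b) = e"
      using that ea eb e by (simp add: O_rle_iff)
    show "e \<cdot> ?d = e" by (rule le_psh_eq[OF A' a b e le eq])
    have "extent A a \<cdot> (e \<cdot> (extent A a \<cdot> extent A b)) = e \<cdot> (extent A a \<cdot> extent A b)"
      using e ea eb by (simp add: O_simps)
    then show "extent A a \<cdot> e = e" unfolding le .
  qed
  have extent_e: "extent A (action A a e) = e" if "e \<in> ?E" for e
    using is_presheafD(6)[OF A' a e(1)[OF that]] e(4)[OF that] by simp
  have "psh_compatible A (action A a e) (action A a e')" if "e \<in> ?E" "e' \<in> ?E" for e e'
    using O_commute[OF e(1)[OF that(1)] e(1)[OF that(2)]]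
    by (simp add: psh_compatible_def extent_e[OF that(1)] extent_e[OF that(2)]
        is_presheafD(3)[OF A' a e(1)[OF that(1)] e(1)[OF that(2)]]
        is_presheafD(3)[OF A' a e(1)[OF that(2)] e(1)[OF that(1)]])
  moreover have "action A a ` ?E \<subseteq> elts A"
    using is_presheafD(1)[OF A' a] by blast
  ultimately obtain c where c: "is_join (psh_le A) (elts A) (action A a ` ?E) c"
    using A unfolding is_sheaf_def by (smt (verit) imageE)
  have cA: "c \<in> elts A" using c by (simp add: is_join_def)
  note ec = is_presheafD(4)[OF A' cA]
  have "Rst C ?d \<cdot> extent A c = Rst C ?d"
  proof (rule join_rst_le[OF psh_eq_join(2)[OF A' a b] ec])
    fix e assume e': "e \<in> ?E"
    note [simp] = e(1)[OF e']
    have "psh_le A (action A a e) c"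
      using c e' unfolding is_join_def by blast
    then have "action A a e = action A c e"
      by (simp only: psh_le_def extent_e[OF e'])
    then have "e = extent A c \<cdot> e"
      using extent_e[OF e'] is_presheafD(6)[OF A' cA, of e] by simp
    then show "Rst C e \<cdot> extent A c = Rst C e"
      using O_commute[OF ec, of e] by simp
  qed
  then have dc: "?d \<cdot> extent A c = ?d" using d by simp
  \<comment> \<open>Used for \<open>a\<close> and for \<open>b\<close>. That \<open>c\<close> lies
    below \<open>action A x ?d\<close> reads \<open>c = action A x (?d \<cdot> extent A c)\<close>,
    and \<open>dc\<close> absorbs the last factor.\<close>
  have "c = action A x ?d" if x: "x \<in> elts A" and eq: "\<And>e. e \<in> ?E \<Longrightarrow> action A a e = action A x e" for x
  proof -
    have "psh_le A (action A a e) (action A x ?d)" if e': "e \<in> ?E" for e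
      using extent_e[OF e'] eq[OF e'] is_presheafD(3)[OF A' x d e(1)[OF e']] e(3)[OF e']
        O_commute[OF d e(1)[OF e']]
      by (simp add: psh_le_def)
    then have "psh_le A c (action A x ?d)"
      using c is_presheafD(1)[OF A' x d] by (auto simp: is_join_def)
    then show ?thesis
      using is_presheafD(3)[OF A' x d ec] dc by (simp add: psh_le_def)
  qed
  from this[OF a] this[OF b e(2)] show ?thesis by metis
qed

text \<open>If the sections coincide, so do their composites with the chart of \<open>b\<close>;
  hence the truth value of \<open>a = b\<close> is the whole extent of \<open>b\<close>, and
  separation applies.\<close>

lemma Delta_section_inj:
  assumes A: "A \<in> Ob (Psh C X)" "is_sheaf C X A"
  shows "inj_on (Delta_section C X A) (elts A)"
proof (rule inj_onI)
  fix a b assume a: "a \<in> elts A" and b: "b \<in> elts A"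
    and eq: "Delta_section C X A a = Delta_section C X A b"
  obtain P where P: "cover C (Delta_ob C X A) P (Delta_section C X A) (elts A)"
    "\<And>a b. a \<in> elts A \<Longrightarrow> b \<in> elts A \<Longrightarrow> P b \<cdot> Delta_section C X A a = psh_eq C X A a b"
    by (rule Delta_cover[OF A(1)]) (rule that)
  have A': "is_presheaf C X A" using A by simp
  have ext: "extent A a = extent A b"
    unfolding Delta_section_partial_section(2)[OF A(1) a, symmetric]
      Delta_section_partial_section(2)[OF A(1) b, symmetric] eq ..
  have "psh_eq C X A a b = extent A b"
    unfolding P(2)[OF a b, symmetric] eq P(2)[OF b b] by (rule psh_eq_refl[OF A' b])
  then have "action A a (extent A b) = action A b (extent A b)"
    using sheaf_action_psh_eq[OF A(2) a b] by (simp only:)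
  then show "a = b"
    using is_presheafD(5)[OF A' a] is_presheafD(5)[OF A' b] unfolding ext by metis
qed

text \<open>Compatibility of the pieces is checked on their sections, where both sides are
  restrictions of \<open>x\<close>, and is pulled back to \<open>A\<close> by injectivity.\<close>

lemma Delta_section_surj:
  assumes A: "A \<in> Ob (Psh C X)" "is_sheaf C X A"
    and x: "partial_section C (Delta_ob C X A) x"
  shows "x \<in> Delta_section C X A ` elts A"
proof -
  let ?s = "Delta_section C X A"
  obtain P where P: "cover C (Delta_ob C X A) P (Delta_section C X A) (elts A)"
    by (rule Delta_cover[OF A(1)]) (rule that)
  interpret cover C "Delta_ob C X A" P ?s "elts A" by (rule P)
  have A': "is_presheaf C X A" using A by simp
  note d = Delta_ob(2,3)[OF A(1)]
  note x' = partial_sectionD[OF d x]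
  define e where "e a = P a \<cdot> x" for a
  have e [simp]: "e a \<in> rest_idem C X" and e_x: "e a \<cdot> Rst C x = e a"
    and xe: "x \<cdot> e a = ?s a \<cdot> e a" if "a \<in> elts A" for a
    using chart_partial_section[OF that x] d by (simp_all add: e_def)
  have ext_e: "extent A (action A a (e a)) = e a" if a: "a \<in> elts A" for a
  proof -
    note s = Delta_section_arrow(1-3)[OF A(1) a]
    \<comment> \<open>The chart takes values in the domain of its section, so \<open>e a\<close>
      lies below \<open>extent A a\<close> and is the full extent of the piece.\<close>
    have "Rst C (?s a) \<cdot> P a = P a"
      using a sect(5)[OF a] comp_assoc[of "P a" "?s a" "P a"] by simp
    then have "extent A a \<cdot> e a = e a"
      using a x' d chart[OF a] Delta_section_partial_section(2)[OF A(1) a]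
        is_presheafD(4)[OF A' a] comp_assoc[of x "P a" "extent A a"] by (simp add: e_def)
    then show ?thesis
      using is_presheafD(6)[OF A' a e[OF a]] by simp
  qed
  have "psh_compatible A (action A a (e a)) (action A b (e b))" if a: "a \<in> elts A" and b: "b \<in> elts A" for a b
  proof -
    note sa = Delta_section_arrow(1-3)[OF A(1) a] and sb = Delta_section_arrow(1-3)[OF A(1) b]
    have "?s (action A a (e a \<cdot> e b)) = (?s a \<cdot> e a) \<cdot> e b"
      using a b sa by (simp add: Delta_section_action[OF A(1)] comp_assoc)
    also have "\<dots> = x \<cdot> (e a \<cdot> e b)"
      using a b x' by (simp add: xe[symmetric] comp_assoc)
    also have "\<dots> = x \<cdot> (e b \<cdot> e a)"
      using O_commute[OF e[OF a] e[OF b]] by simp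
    also have "\<dots> = (?s b \<cdot> e b) \<cdot> e a"
      using a b x' by (simp add: xe[symmetric] comp_assoc)
    also have "\<dots> = ?s (action A b (e b \<cdot> e a))"
      using a b sb by (simp add: Delta_section_action[OF A(1)] comp_assoc)
    finally have "action A a (e a \<cdot> e b) = action A b (e b \<cdot> e a)"
      using inj_onD[OF Delta_section_inj[OF A]] is_presheafD(1)[OF A'] a b by simp
    then show ?thesis
      using a b by (simp add: psh_compatible_def ext_e is_presheafD(3)[OF A'])
  qed
  moreover have "(\<lambda>a. action A a (e a)) ` elts A \<subseteq> elts A"
    using is_presheafD(1)[OF A'] by auto
  ultimately obtain c where c: "is_join (psh_le A) (elts A) ((\<lambda>a. action A a (e a)) ` elts A) c"
    using A(2) unfolding is_sheaf_def by (smt (verit) imageE)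
  have cA: "c \<in> elts A" using c by (simp add: is_join_def)
  note ec = is_presheafD(4)[OF A' cA] and sc = Delta_section_arrow(1-3)[OF A(1) cA]
  have ce: "action A c (e a) = action A a (e a)" if "a \<in> elts A" for a
  proof -
    have "psh_le A (action A a (e a)) c"
      using c that unfolding is_join_def by blast
    then show ?thesis
      by (simp only: psh_le_def ext_e[OF that])
  qed
  \<comment> \<open>The idempotents \<open>e a\<close> cover the domain of \<open>x\<close>, and on
    each of them both maps equal the section of \<open>a\<close>.\<close>
  have "?s c \<cdot> Rst C x = x \<cdot> Rst C x"
  proof (rule eq_on_partial_section[OF x])
    fix a assume a: "a \<in> elts A"
    have "?s c \<cdot> e a = ?s a \<cdot> e a"
      using Delta_section_action[OF A(1) cA e[OF a]] Delta_section_action[OF A(1) a e[OF a]] ce[OF a]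
      by simp
    then show "?s c \<cdot> (P a \<cdot> x) = x \<cdot> (P a \<cdot> x)"
      using xe[OF a] by (simp add: e_def)
  qed (use d x' sc in \<open>simp_all add: Hom_iff\<close>)
  \<comment> \<open>\<open>c\<close> does not extend beyond the domain of \<open>x\<close>:
    \<open>action A c (Rst C x)\<close> is still an upper bound of the pieces, and \<open>c\<close>
    is the least one.\<close>
  moreover have "?s c \<cdot> Rst C x = ?s c"
  proof -
    have "psh_le A (action A a (e a)) (action A c (Rst C x))" if a: "a \<in> elts A" for a
      using ce[OF a] is_presheafD(3)[OF A' cA x'(5) e[OF a]] ext_e[OF a] e_x[OF a]
        O_commute[OF e[OF a] x'(5)]
      by (simp add: psh_le_def)
    then have "psh_le A c (action A c (Rst C x))"
      using c is_presheafD(1)[OF A' cA x'(5)] by (auto simp: is_join_def)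
    then have "action A c (Rst C x) = c"
      using is_presheafD(3)[OF A' cA x'(5) ec] is_presheafD(3)[OF A' cA ec x'(5)]
        is_presheafD(5)[OF A' cA] O_commute[OF ec x'(5)]
      by (simp add: psh_le_def)
    then show ?thesis
      using Delta_section_action[OF A(1) cA x'(5)] by simp
  qed
  ultimately have "?s c = x" using x' by simp
  with cA show ?thesis by blast
qed

lemma unit_invertible_sheaf:
  assumes A: "A \<in> Ob (Psh C X)" "is_sheaf C X A"
  shows "invertible (Psh C X) (Delta_unit C X A)"
  unfolding Delta_unit_def
proof (rule presheaf_map_invertible[OF A(1) _ presheaf_map_Delta_section[OF A(1)]])
  note d = Delta_ob(2,3)[OF A(1)]
  show "Gamma_ob C (Delta_ob C X A) \<in> Ob (Psh C X)"
    using presheaf_Gamma[OF d] small_Gamma[OF d] by simp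
  show "bij_betw (\<lambda>a\<in>elts A. Delta_section C X A a) (elts A) (elts (Gamma_ob C (Delta_ob C X A)))"
    using Delta_section_inj[OF A] Delta_section_surj[OF A] Delta_section_partial_section(1)[OF A(1)]
    by (auto simp: bij_betw_def inj_on_def)
qed

end

theorem corollary4p16:
  fixes C :: "('o, 'm) rcat" and X :: 'o
  assumes "join_restriction_category C"
    and "locally_small C"
    and "has_local_glueings C"
    and "X \<in> Ob C"
  shows "galois_adjunction (Psh C X) (slice_t C X) (Delta C X) (Gamma C) (Delta_unit C X) (Delta_counit C X)
    \<and> reflective_via (Psh C X) (Sh C X) (comp_functor (Gamma C) (Delta C X)) (Delta_unit C X)
    \<and> coreflective_via (slice_t C X) (slice_lh C X) (comp_functor (Delta C X) (Gamma C)) (Delta_counit C X)"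
proof -
  interpret glueing_base C X
    using assms by (simp add: glueing_base_def glueing_base_axioms_def)
  have lh: "local_homeomorphism C (Delta_ob C X A)" "Cod C (Delta_ob C X A) = X"
    "total_map C (Delta_ob C X A)" if "A \<in> Ob (Psh C X)" for A
    using Delta_ob[OF that] by simp_all
  have "galois_adjunction (Psh C X) (slice_t C X) (Delta C X) (Gamma C) (Delta_unit C X) (Delta_counit C X)"
    using adjunction_Delta_Gamma lh counit_invertible_local_homeomorphism[OF lh(1,2)]
    by (simp add: galois_adjunction_def left_fixpoint_def)
  moreover have "reflective_via (Psh C X) (Sh C X) (comp_functor (Gamma C) (Delta C X)) (Delta_unit C X)"
    unfolding Sh_def
    by (rule adjoint_pair.reflective[OF adjoint_pair_Delta_Gamma]) (use sheaf_Gamma lh unit_invertible_sheaf in simp_all)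
  moreover have "coreflective_via (slice_t C X) (slice_lh C X) (comp_functor (Delta C X) (Gamma C)) (Delta_counit C X)"
    unfolding slice_lh_def
    by (rule adjoint_pair.coreflective[OF adjoint_pair_Delta_Gamma])
      (use lh(1) presheaf_Gamma small_Gamma counit_invertible_local_homeomorphism in simp_all)
  ultimately show ?thesis by blast
qed

end
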